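(* Let $Z\subset\mathbb{P}^2$ be a finite set of $r$ points and let $k\ge5$ be an integer. If $p$ is an integer such that $$\alpha(I(Z))=p,\ \alpha(I(2Z))=p+2,\ \dots,\ \alpha(I(kZ))=p+2(k-1),$$ then $p=2$, i.e. the points of $Z$ are contained in a single conic.
   Context: Work over an algebraically closed field $\mathbb{K}$ of characteristic zero, $R=\mathbb{K}[x_0,x_1,x_2]$. For $Z=\{P_1,\dots,P_r\}$, $I(P_i)$ is the homogeneous maximal ideal of $P_i$ and $I(jZ)=I(P_1)^j\cap\dots\cap I(P_r)^j$ (the $j$-th symbolic power of $I(Z)=I(1Z)$). For a homogeneous ideal $J$, $\alpha(J)=\min\{n:J_n\ne0\}$ is its initial degree. *)

theory Defs
  imports "HOL-Library.Poly_Mapping" "HOL-Library.Product_Plus"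
          "HOL-Computational_Algebra.Polynomial"
begin

text \<open>Polynomials in R = K[x0,x1,x2]: finitely supported maps from exponent
  triples (a,b,c) (monomial x0^a x1^b x2^c) to coefficients; multiplication is
  the convolution product of Poly_Mapping.\<close>

type_synonym 'a poly3 = "(nat \<times> nat \<times> nat) \<Rightarrow>\<^sub>0 'a"

definition mdeg :: "nat \<times> nat \<times> nat \<Rightarrow> nat" where
  "mdeg m = (case m of (a, b, c) \<Rightarrow> a + b + c)"

definition eval3 :: "'a::comm_semiring_1 poly3 \<Rightarrow> 'a \<times> 'a \<times> 'a \<Rightarrow> 'a" where
  "eval3 f P = (case P of (x, y, z) \<Rightarrow>
     (\<Sum>m\<in>Poly_Mapping.keys f. Poly_Mapping.lookup f m * (case m of (a, b, c) \<Rightarrow> x ^ a * y ^ b * z ^ c)))"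

definition homogeneous_of :: "nat \<Rightarrow> 'a::zero poly3 \<Rightarrow> bool" where
  "homogeneous_of n f \<longleftrightarrow> (\<forall>m\<in>Poly_Mapping.keys f. mdeg m = n)"

definition hcomp :: "nat \<Rightarrow> 'a::zero poly3 \<Rightarrow> 'a poly3" where
  "hcomp n f = Abs_poly_mapping (\<lambda>m. if mdeg m = n then Poly_Mapping.lookup f m else 0)"

text \<open>Homogeneous maximal ideal I(P) of a point P (given by a nonzero
  representative): polynomials all of whose homogeneous components vanish at P.\<close>
definition IP :: "'a::comm_ring_1 \<times> 'a \<times> 'a \<Rightarrow> 'a poly3 set" where
  "IP P = {f. \<forall>n. eval3 (hcomp n f) P = 0}"

inductive_set ideal_gen :: "'b::comm_ring_1 set \<Rightarrow> 'b set" for S where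
  zero: "0 \<in> ideal_gen S"
| gen: "g \<in> S \<Longrightarrow> g \<in> ideal_gen S"
| add: "a \<in> ideal_gen S \<Longrightarrow> b \<in> ideal_gen S \<Longrightarrow> a + b \<in> ideal_gen S"
| mult: "a \<in> ideal_gen S \<Longrightarrow> r * a \<in> ideal_gen S"

definition ideal_pow :: "'b::comm_ring_1 set \<Rightarrow> nat \<Rightarrow> 'b set" where
  "ideal_pow I j = ideal_gen {prod_list fs | fs. length fs = j \<and> set fs \<subseteq> I}"

definition IZ :: "nat \<Rightarrow> ('a::comm_ring_1 \<times> 'a \<times> 'a) set \<Rightarrow> 'a poly3 set" where
  "IZ j Z = (\<Inter>P\<in>Z. ideal_pow (IP P) j)"

definition alpha :: "'a::zero poly3 set \<Rightarrow> nat" where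
  "alpha J = (LEAST n. \<exists>f\<in>J. f \<noteq> 0 \<and> homogeneous_of n f)"

end

theory Submission
  imports Defs "Berlekamp_Zassenhaus.Unique_Factorization_Poly"
begin

text \<open>
  Let \<open>p = \<alpha>(I(Z))\<close>. Squaring a form of degree \<open>p\<close> in \<open>I(Z)\<close> gives \<open>p \<ge> 2\<close>, so let \<open>p \<ge> 3\<close> and let
  \<open>F\<close> be a form of degree \<open>p + 8\<close> with multiplicity at least 5 along \<open>Z\<close>.

  A minimal subset \<open>W\<close> of \<open>Z\<close> lying on no curve of degree \<open>p - 1\<close> has \<open>p(p + 1)/2\<close> points, and every
  \<open>w\<close> in \<open>W\<close> is separated from the others by a curve \<open>G\<^sub>w\<close> of degree \<open>p - 1\<close> through \<open>W - {w}\<close>.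
  Intersecting an irreducible curve of degree \<open>d\<close> through \<open>w\<close> with \<open>G\<^sub>w\<close> and with a line through \<open>w\<close>
  shows that its multiplicities along \<open>W\<close> add up to at most \<open>p d\<close>. Summing over the components of \<open>F\<close> gives
  Chudnovsky's inequality \<open>5 p (p + 1)/2 \<le> p (p + 8)\<close>, whence \<open>p = 3\<close>.

  For \<open>p = 3\<close> the six points of \<open>W\<close> are not on a conic. Similar weighted inequalities, obtained by
  intersecting the components of \<open>F\<close> with lines and conics through points of \<open>Z\<close>, show in turn that every point of \<open>W\<close> is on
  a line through three points of \<open>W\<close>, that \<open>W\<close> consists of the pairwise intersections of four lines, and
  that \<open>Z\<close> has no further point. Then the product of the four lines is a quartic in \<open>I(2Z)\<close>, contradicting
  \<open>\<alpha>(I(2Z)) = 5\<close>.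
\<close>

section \<open>Plane polynomials: degree and multiplicity\<close>

text \<open>Gaussian elimination, by induction on the equations \<open>T\<close>: a nonzero
  coefficient of the new equation serves as pivot, which uses up one equation and one
  unknown.\<close>

lemma nontrivial_solution:
  fixes M :: "'t \<Rightarrow> 's \<Rightarrow> 'a::field"
  assumes "finite T" "finite S" "card T < card S"
  shows "\<exists>x. (\<exists>s\<in>S. x s \<noteq> 0) \<and> (\<forall>t\<in>T. (\<Sum>s\<in>S. x s * M t s) = 0)"
  using assms
proof (induction T arbitrary: S M rule: finite_induct)
  case empty
  then obtain s where "s \<in> S" by (metis card.empty card_gt_0_iff ex_in_conv)
  then show ?case by (intro exI[of _ "\<lambda>_. 1"]) auto
next
  case (insert t T)
  show ?case
  proof (cases "\<exists>s\<in>S. M t s \<noteq> 0")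
    case False
    have "card T < card S" using insert by simp
    from insert.IH[OF insert.prems(1) this, of M] obtain x where
      x: "\<exists>s\<in>S. x s \<noteq> 0" "\<forall>t\<in>T. (\<Sum>s\<in>S. x s * M t s) = 0" by blast
    have "(\<Sum>s\<in>S. x s * M t s) = 0" using False by (intro sum.neutral) auto
    with x show ?thesis by blast
  next
    case True
    then obtain r where r: "r \<in> S" "M t r \<noteq> 0" by blast
    \<comment> \<open>The system left after the unknown \<open>r\<close> has been eliminated by
      means of equation \<open>t\<close>.\<close>
    define N where "N t' s = M t' s - M t' r / M t r * M t s" for t' s
    have "card T < card (S - {r})" using insert r by simp
    from insert.IH[OF _ this, of N] insert.prems(1) obtain x where
      x: "\<exists>s\<in>S - {r}. x s \<noteq> 0" "\<forall>t\<in>T. (\<Sum>s\<in>S - {r}. x s * N t s) = 0" by auto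
    \<comment> \<open>Back substitution: the value at \<open>r\<close> is chosen so that equation
      \<open>t\<close> holds.\<close>
    define y where "y = x(r := - (\<Sum>s\<in>S - {r}. x s * M t s) / M t r)"
    have split: "(\<Sum>s\<in>S. y s * M t' s) = y r * M t' r + (\<Sum>s\<in>S - {r}. x s * M t' s)" for t'
    proof -
      have "(\<Sum>s\<in>S. y s * M t' s) = y r * M t' r + (\<Sum>s\<in>S - {r}. y s * M t' s)"
        using insert.prems(1) r(1) by (rule sum.remove)
      also have "(\<Sum>s\<in>S - {r}. y s * M t' s) = (\<Sum>s\<in>S - {r}. x s * M t' s)"
        by (rule sum.cong) (auto simp: y_def)
      finally show ?thesis .
    qed
    have "(\<Sum>s\<in>S. y s * M t s) = 0" unfolding split using r by (simp add: y_def)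
    moreover have "(\<Sum>s\<in>S. y s * M t' s) = 0" if "t' \<in> T" for t'
    proof -
      have "0 = (\<Sum>s\<in>S - {r}. x s * N t' s)" using x that by simp
      also have "\<dots> = (\<Sum>s\<in>S - {r}. x s * M t' s - M t' r / M t r * (x s * M t s))"
        by (rule sum.cong) (auto simp: N_def algebra_simps)
      also have "\<dots> = (\<Sum>s\<in>S - {r}. x s * M t' s) - M t' r / M t r * (\<Sum>s\<in>S - {r}. x s * M t s)"
        by (simp add: sum_subtractf sum_distrib_left)
      finally show ?thesis unfolding split by (simp add: y_def)
    qed
    moreover have "\<exists>s\<in>S. y s \<noteq> 0" using x(1) by (auto simp: y_def)
    ultimately show ?thesis by blast
  qed
qed

text \<open>In \<^typ>\<open>'a poly poly\<close> the inner variable is \<open>x\<close> and the outer one is \<open>y\<close>; accordingly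
  \<open>bmonom i j\<close> below is \<open>x\<^sup>j y\<^sup>i\<close>.\<close>

definition const2 :: "'a::comm_ring_1 \<Rightarrow> 'a poly poly" where
  "const2 k = [:[:k:]:]"

definition bmonom :: "nat \<Rightarrow> nat \<Rightarrow> 'a::comm_ring_1 poly poly" where
  "bmonom i j = monom (monom 1 j) i"

definition subst2 :: "'a::comm_ring_1 poly poly \<Rightarrow> 'a poly poly \<Rightarrow> 'a poly poly \<Rightarrow> 'a poly poly" where
  "subst2 X Y g = poly (map_poly (\<lambda>c. poly (map_poly const2 c) X) g) Y"

definition poly2 :: "'a::comm_ring_1 poly poly \<Rightarrow> 'a \<times> 'a \<Rightarrow> 'a" where
  "poly2 g P = poly (poly g [:snd P:]) (fst P)"

lemma poly2_simps [simp]: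
  "poly2 0 P = 0" "poly2 1 P = 1" "poly2 (g + h) P = poly2 g P + poly2 h P"
  "poly2 (g * h) P = poly2 g P * poly2 h P" "poly2 (g - h) P = poly2 g P - poly2 h P"
  "poly2 (- g) P = - poly2 g P" "poly2 (g ^ n) P = poly2 g P ^ n" "poly2 (const2 k) P = k"
  for g h :: "'a::comm_ring_1 poly poly"
  by (simp_all add: poly2_def const2_def poly_power)

lemma poly2_sum: "poly2 (\<Sum>x\<in>A. f x) P = (\<Sum>x\<in>A. poly2 (f x) P)"
  by (simp add: poly2_def poly_sum)

lemma poly2_prod: "poly2 (\<Prod>x\<in>A. f x) P = (\<Prod>x\<in>A. poly2 (f x) P)"
  by (simp add: poly2_def poly_prod)

lemma const2_simps [simp]:
  "const2 0 = 0" "const2 1 = 1" "const2 (a + b) = const2 a + const2 b"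
  "const2 (a * b) = const2 a * const2 b"
  by (simp_all add: const2_def)

lemma coeff_const2_mult: "coeff (coeff (const2 k * g) i) j = k * coeff (coeff g i) j"
  by (simp add: const2_def)

interpretation const2: comm_ring_hom "const2 :: 'a::comm_ring_1 \<Rightarrow> _"
  by unfold_locales (auto simp: const2_def)

interpretation const2_map: map_poly_comm_ring_hom "const2 :: 'a::comm_ring_1 \<Rightarrow> _" ..

lemma comm_ring_hom_subst: "comm_ring_hom (\<lambda>c. poly (map_poly const2 c) X)"
  by unfold_locales (simp_all add: const2_map.hom_add const2_map.hom_mult)

lemma comm_ring_hom_subst2: "comm_ring_hom (subst2 X Y)"
proof -
  interpret h: comm_ring_hom "\<lambda>c. poly (map_poly const2 c) X" by (rule comm_ring_hom_subst)
  interpret mh: map_poly_comm_ring_hom "\<lambda>c. poly (map_poly const2 c) X" ..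
  show ?thesis
    unfolding subst2_def by unfold_locales (auto simp: mh.hom_add mh.hom_mult)
qed

lemma bivariate_expansion:
  "g = (\<Sum>i\<le>degree g. \<Sum>j\<le>degree (coeff g i). const2 (coeff (coeff g i) j) * bmonom i j)"
proof -
  have "g = (\<Sum>i\<le>degree g. monom (coeff g i) i)" by (simp add: poly_as_sum_of_monoms)
  also have "\<dots> = (\<Sum>i\<le>degree g. monom (\<Sum>j\<le>degree (coeff g i). monom (coeff (coeff g i) j) j) i)"
    by (simp add: poly_as_sum_of_monoms)
  also have "\<dots> = (\<Sum>i\<le>degree g. \<Sum>j\<le>degree (coeff g i). monom (monom (coeff (coeff g i) j) j) i)"
    by (simp add: monom_hom.hom_sum)
  also have "\<dots> = (\<Sum>i\<le>degree g. \<Sum>j\<le>degree (coeff g i). const2 (coeff (coeff g i) j) * bmonom i j)"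
    by (simp add: const2_def bmonom_def smult_monom)
  finally show ?thesis .
qed

lemma subst2_const2 [simp]: "subst2 X Y (const2 k) = const2 k"
  by (cases "k = 0") (simp_all add: subst2_def const2_def map_poly_pCons)

lemma subst2_bmonom: "subst2 X Y (bmonom i j) = X ^ j * Y ^ i"
  by (simp add: subst2_def bmonom_def map_poly_monom poly_monom)

text \<open>Identities between additive maps, such as the value of a blowup at a point, thereby
  reduce to scaled monomials, where they can be computed.\<close>

lemma bivariate_induct [case_names monom add]:
  assumes "\<And>c i j. Q (const2 c * bmonom i j)" and "\<And>g h. Q g \<Longrightarrow> Q h \<Longrightarrow> Q (g + h)"
  shows "Q g"
proof -
  have 0: "Q 0" using assms(1)[of 0] by simp
  have sum: "Q (\<Sum>x\<in>A. f x)" if "\<And>x. x \<in> A \<Longrightarrow> Q (f x)" "finite A" for A :: "nat set" and f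
    using that(2,1) by (induction A rule: finite_induct) (auto intro: 0 assms(2))
  show ?thesis
    by (subst bivariate_expansion) (intro sum assms(1) finite_atMost)
qed

lemma poly2_bmonom: "poly2 (bmonom i j) P = fst P ^ j * snd P ^ i"
  by (simp add: poly2_def bmonom_def poly_monom poly_power)

text \<open>\<open>blowup (a, b) g\<close> is \<open>g(a + t, b + t s)\<close> with \<open>s\<close> the inner and \<open>t\<close> the outer variable. A monomial
  of degree \<open>k\<close> centred at \<open>(a, b)\<close> becomes \<open>t\<^sup>k\<close> times a power of \<open>s\<close> and no cancellation occurs, so total degree and
  multiplicity of \<open>g\<close> are the degree and the order in \<open>t\<close>, and both are additive for free.\<close>

definition blowup :: "'a::comm_ring_1 \<times> 'a \<Rightarrow> 'a poly poly \<Rightarrow> 'a poly poly" where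
  "blowup P = subst2 [:[:fst P:], 1:] [:[:snd P:], [:0, 1:]:]"

interpretation blowup: comm_ring_hom "blowup P"
  unfolding blowup_def by (rule comm_ring_hom_subst2)

lemma blowup_const2 [simp]: "blowup P (const2 k) = const2 k"
  by (simp add: blowup_def)

lemma blowup_bmonom: "blowup P (bmonom i j) = [:[:fst P:], 1:] ^ j * [:[:snd P:], [:0, 1:]:] ^ i"
  by (simp add: blowup_def subst2_bmonom)

lemma poly2_blowup: "poly2 (blowup P g) (s, t) = poly2 g (fst P + t, snd P + t * s)"
proof (induction g rule: bivariate_induct)
  case (monom c i j)
  show ?case
    by (simp add: blowup.hom_mult blowup_bmonom poly2_bmonom)
       (simp add: poly2_def algebra_simps)
qed (simp add: blowup.hom_add)

text \<open>At the origin \<open>x^j y^i\<close> becomes \<open>t^(i+j) s^i\<close>. Distinct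
  monomials stay distinct, so coefficients can be read off directly.\<close>

lemma coeff_blowup_0:
  "coeff (coeff (blowup (0, 0) g) k) j = (if j \<le> k then coeff (coeff g j) (k - j) else 0)"
proof (induction g rule: bivariate_induct)
  case (monom c i l)
  have "blowup (0, 0) (bmonom i l) = (bmonom (i + l) i :: 'a poly poly)"
  proof -
    have "[:[:0:], 1:] = monom (1 :: 'a poly) 1" "[:[:0:], [:0, 1:]:] = monom (monom (1 :: 'a) 1) 1"
      by (simp_all add: monom_Suc monom_0)
    then show ?thesis
      unfolding blowup_bmonom by (simp add: bmonom_def monom_power mult_monom add.commute)
  qed
  then show ?case
    by (auto simp: blowup.hom_mult coeff_const2_mult bmonom_def)
qed (simp add: blowup.hom_add)

text \<open>The definition of \<open>poly2\<close> specialises \<open>y\<close> first. Specialising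
  \<open>x\<close> first leaves a polynomial in \<open>y\<close> alone, whose leading coefficient
  can be kept nonzero.\<close>

lemma poly2_bivariate: "poly2 g (a, b) = poly (map_poly (\<lambda>c. poly c a) g) b"
proof -
  interpret comm_ring_hom "\<lambda>c. poly c a" by unfold_locales auto
  interpret map_poly_comm_ring_hom "\<lambda>c. poly c a" ..
  show ?thesis
  proof (induction g rule: bivariate_induct)
    case (monom c i j)
    show ?case
      by (simp add: poly2_bmonom) (simp add: const2_def bmonom_def smult_monom map_poly_monom poly_monom)
  qed (simp add: hom_add)
qed

text \<open>Take \<open>a\<close> off the roots of the leading coefficient, then \<open>b\<close>
  off the roots of the specialised polynomial. Avoiding \<open>A\<close> serves to invert a blowup,
  which requires \<open>a\<close> to differ from the first coordinate of the centre.\<close>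

lemma poly2_nonzero:
  fixes g :: "'a::{field_char_0} poly poly"
  assumes "g \<noteq> 0" "finite A"
  obtains a b where "a \<notin> A" "poly2 g (a, b) \<noteq> 0"
proof -
  have "finite (A \<union> {a. poly (lead_coeff g) a = 0})"
    using assms by (auto intro: poly_roots_finite)
  then obtain a where a: "a \<notin> A" "poly (lead_coeff g) a \<noteq> 0"
    using ex_new_if_finite[OF infinite_UNIV_char_0] by blast
  have "coeff (map_poly (\<lambda>c. poly c a) g) (degree g) = poly (lead_coeff g) a"
    by (rule coeff_map_poly) simp
  then have "map_poly (\<lambda>c. poly c a) g \<noteq> 0" using a by (metis coeff_0)
  then have "finite {b. poly (map_poly (\<lambda>c. poly c a) g) b = 0}" by (rule poly_roots_finite)
  then obtain b where "poly (map_poly (\<lambda>c. poly c a) g) b \<noteq> 0"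
    using ex_new_if_finite[OF infinite_UNIV_char_0] by blast
  with a that show ?thesis by (simp add: poly2_bivariate)
qed

lemma blowup_eq_0_iff [simp]: "blowup P g = 0 \<longleftrightarrow> g = 0"
  for g :: "'a::field_char_0 poly poly"
proof
  assume *: "blowup P g = 0"
  show "g = 0"
  proof (rule ccontr)
    assume "g \<noteq> 0"
    then obtain a b where ab: "a \<notin> {fst P}" "poly2 g (a, b) \<noteq> 0" by (rule poly2_nonzero[of g "{fst P}"]) auto
    \<comment> \<open>Away from the vertical line through \<open>P\<close>, the parameters
      \<open>t\<close> and \<open>s\<close> are the horizontal displacement and the slope.\<close>
    have "poly2 (blowup P g) ((b - snd P) / (a - fst P), a - fst P) = poly2 g (a, b)"
      using ab by (subst poly2_blowup) simp
    then show False using * ab by simp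
  qed
qed simp

lemma degree_coeff_mult_le:
  assumes "\<And>k. degree (coeff g k) \<le> k" "\<And>k. degree (coeff h k) \<le> k"
  shows "degree (coeff (g * h) k) \<le> k"
  unfolding coeff_mult
proof (rule degree_sum_le)
  fix i assume "i \<in> {..k}"
  have "degree (coeff g i * coeff h (k - i)) \<le> degree (coeff g i) + degree (coeff h (k - i))"
    by (rule degree_mult_le)
  also have "\<dots> \<le> i + (k - i)" by (intro add_mono assms)
  finally show "degree (coeff g i * coeff h (k - i)) \<le> k" using \<open>i \<in> {..k}\<close> by simp
qed simp

lemma degree_coeff_power_le:
  assumes "\<And>k. degree (coeff g k) \<le> k"
  shows "degree (coeff (g ^ n) k) \<le> k"
proof (induction n arbitrary: k)
  case 0
  show ?case by (simp add: coeff_1)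
next
  case (Suc n)
  show ?case unfolding power_Suc by (rule degree_coeff_mult_le[OF assms Suc])
qed

text \<open>The variable \<open>s\<close> enters only through \<open>t s\<close>, so its exponent
  never exceeds that of \<open>t\<close>. Hence vanishing to a given order is a finite list of
  conditions.\<close>

lemma degree_coeff_blowup: "degree (coeff (blowup P g) k) \<le> k"
proof (induction g rule: bivariate_induct)
  case (monom c i j)
  have "degree (coeff [:[:fst P:], 1:] k) \<le> k" "degree (coeff [:[:snd P:], [:0, 1:]:] k) \<le> k"
    "degree (coeff (const2 c) k) \<le> k" for k
    by (auto simp: const2_def coeff_pCons split: nat.split)
  then show ?case
    unfolding blowup.hom_mult blowup_const2 blowup_bmonom
    by (intro degree_coeff_mult_le degree_coeff_power_le)
next
  case (add g h)
  then show ?case by (simp add: blowup.hom_add degree_add_le)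
qed

section \<open>Total degree\<close>

definition tdeg :: "'a::comm_ring_1 poly poly \<Rightarrow> nat" where
  "tdeg g = degree (blowup (0, 0) g)"

lemma tdeg_le_iff: "tdeg g \<le> n \<longleftrightarrow> (\<forall>i j. n < i + j \<longrightarrow> coeff (coeff g i) j = 0)"
proof
  assume *: "tdeg g \<le> n"
  show "\<forall>i j. n < i + j \<longrightarrow> coeff (coeff g i) j = 0"
  proof (intro allI impI)
    fix i j assume "n < i + j"
    then have "coeff (blowup (0, 0) g) (i + j) = 0"
      using * by (intro coeff_eq_0) (simp add: tdeg_def)
    then show "coeff (coeff g i) j = 0" using coeff_blowup_0[of g "i + j" i] by simp
  qed
next
  assume *: "\<forall>i j. n < i + j \<longrightarrow> coeff (coeff g i) j = 0"
  show "tdeg g \<le> n"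
    unfolding tdeg_def by (rule degree_le) (auto intro!: poly_eqI simp: coeff_blowup_0 *)
qed

lemma tdeg_simps [simp]: "tdeg 0 = 0" "tdeg 1 = 0" "tdeg (const2 c) = 0"
  by (simp_all add: tdeg_def) (simp add: const2_def)

lemma tdeg_diff_le: "tdeg g \<le> n \<Longrightarrow> tdeg h \<le> n \<Longrightarrow> tdeg (g - h) \<le> n"
  by (simp add: tdeg_def blowup.hom_minus degree_diff_le)

lemma tdeg_sum_le: "finite A \<Longrightarrow> (\<And>x. x \<in> A \<Longrightarrow> tdeg (f x) \<le> n) \<Longrightarrow> tdeg (\<Sum>x\<in>A. f x) \<le> n"
  by (simp add: tdeg_def blowup.hom_sum degree_sum_le)

lemma tdeg_mult_le: "tdeg g \<le> m \<Longrightarrow> tdeg h \<le> n \<Longrightarrow> tdeg (g * h) \<le> m + n"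
  unfolding tdeg_def blowup.hom_mult by (rule order_trans[OF degree_mult_le add_mono])

lemma tdeg_power_le: "tdeg g \<le> m \<Longrightarrow> tdeg (g ^ n) \<le> m * n"
  by (induction n) (auto dest: tdeg_mult_le)

lemma tdeg_prod_le: "(\<And>x. x \<in> A \<Longrightarrow> tdeg (f x) \<le> n x) \<Longrightarrow> tdeg (\<Prod>x\<in>A. f x) \<le> (\<Sum>x\<in>A. n x)"
  by (induction A rule: infinite_finite_induct) (auto intro: tdeg_mult_le)

lemma tdeg_mult: "g \<noteq> 0 \<Longrightarrow> h \<noteq> 0 \<Longrightarrow> tdeg (g * h) = tdeg g + tdeg h"
  for g h :: "'a::field_char_0 poly poly"
  by (simp add: tdeg_def blowup.hom_mult degree_mult_eq)

lemma tdeg_bmonom: "tdeg (bmonom i j) \<le> i + j"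
  by (auto simp: tdeg_le_iff bmonom_def)

lemma degree_le_tdeg: "degree g \<le> tdeg g"
proof (cases "g = 0")
  case False
  then obtain j where "coeff (lead_coeff g) j \<noteq> 0" by (metis leading_coeff_neq_0 poly_eqI coeff_0)
  then show ?thesis using tdeg_le_iff[of g "tdeg g"] by (meson le_trans le_add1 not_le order_refl)
qed simp

text \<open>Moving the centre does not raise the degree in \<open>t\<close>, as is seen on
  monomials. This is why no multiplicity exceeds the total degree.\<close>

lemma degree_blowup_le: "degree (blowup P g) \<le> tdeg g"
proof -
  have 1: "degree (blowup P (bmonom i j)) \<le> i + j" for i j
    unfolding blowup_bmonom
    by (rule order_trans[OF degree_mult_le], subst add.commute, intro add_mono)
       (rule order_trans[OF degree_power_le], simp add: degree_pCons_le)+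
  show ?thesis
    apply (subst bivariate_expansion[of g])
    unfolding blowup.hom_sum blowup.hom_mult blowup_const2
  proof (intro degree_sum_le finite_atMost)
    fix i j
    show "degree (const2 (coeff (coeff g i) j) * blowup P (bmonom i j)) \<le> tdeg g"
    proof (cases "i + j \<le> tdeg g")
      case True
      have "degree (const2 (coeff (coeff g i) j) * blowup P (bmonom i j)) \<le> i + j"
        by (rule order_trans[OF degree_mult_le]) (use 1 in \<open>simp add: const2_def\<close>)
      with True show ?thesis by simp
    next
      case False
      then have "coeff (coeff g i) j = 0" using tdeg_le_iff[of g "tdeg g"] by simp
      then show ?thesis by simp
    qed
  qed
qed

section \<open>Multiplicity at a point\<close>

definition mult_at :: "'a::idom \<times> 'a \<Rightarrow> 'a poly poly \<Rightarrow> nat" where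
  "mult_at P g = Polynomial.order 0 (blowup P g)"

text \<open>Expressed by divisibility and not by \<open>mult_at\<close>, so that the zero polynomial
  vanishes to every order and the condition is linear.\<close>

definition vanishes :: "nat \<Rightarrow> 'a::comm_ring_1 \<times> 'a \<Rightarrow> 'a poly poly \<Rightarrow> bool" where
  "vanishes m P g \<longleftrightarrow> monom 1 m dvd blowup P g"

lemma vanishes_iff_mult_at: "vanishes m P g \<longleftrightarrow> g = 0 \<or> m \<le> mult_at P g"
  for g :: "'a::field_char_0 poly poly"
  by (cases "g = 0") (simp_all add: vanishes_def mult_at_def monom_1_dvd_iff)

lemma mult_at_mult: "g \<noteq> 0 \<Longrightarrow> h \<noteq> 0 \<Longrightarrow> mult_at P (g * h) = mult_at P g + mult_at P h"
  for g h :: "'a::field_char_0 poly poly"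
  by (simp add: mult_at_def blowup.hom_mult order_mult)

lemma mult_at_le_tdeg: "g \<noteq> 0 \<Longrightarrow> mult_at P g \<le> tdeg g"
  for g :: "'a::field_char_0 poly poly"
  unfolding mult_at_def by (rule order_trans[OF order_degree degree_blowup_le]) simp

text \<open>Turns vanishing to order \<open>m\<close> into \<open>m (m + 1) / 2\<close> linear
  equations, in the form in which they enter the count for Bezout's inequality.\<close>

lemma vanishes_coeff_iff:
  "vanishes m P g \<longleftrightarrow> (\<forall>k<m. \<forall>j\<le>k. coeff (coeff (blowup P g) k) j = 0)"
proof -
  have "coeff (blowup P g) k = 0" if "\<forall>j\<le>k. coeff (coeff (blowup P g) k) j = 0" for k
  proof (rule poly_eqI)
    fix j show "coeff (coeff (blowup P g) k) j = coeff 0 j"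
    proof (cases "j \<le> k")
      case False
      then show ?thesis using degree_coeff_blowup[of P g k] by (simp add: coeff_eq_0)
    qed (use that in simp)
  qed
  then show ?thesis unfolding vanishes_def monom_1_dvd_iff' by auto
qed

lemma vanishes_add: "vanishes m P g \<Longrightarrow> vanishes m P h \<Longrightarrow> vanishes m P (g + h)"
  by (simp add: vanishes_def blowup.hom_add)

lemma vanishes_diff: "vanishes m P g \<Longrightarrow> vanishes m P h \<Longrightarrow> vanishes m P (g - h)"
  by (simp add: vanishes_def blowup.hom_minus)

lemma vanishes_sum: "(\<And>x. x \<in> A \<Longrightarrow> vanishes m P (f x)) \<Longrightarrow> vanishes m P (\<Sum>x\<in>A. f x)"
  by (simp add: vanishes_def blowup.hom_sum dvd_sum)

lemma vanishes_mult: "vanishes m P g \<Longrightarrow> vanishes n P h \<Longrightarrow> vanishes (m + n) P (g * h)"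
  using mult_dvd_mono[of "monom 1 m" _ "monom 1 n"]
  by (simp add: vanishes_def blowup.hom_mult mult_monom)

lemma vanishes_0 [simp]: "vanishes 0 P g"
  by (simp add: vanishes_def monom_1_dvd_iff')

lemma vanishes_power: "vanishes m P g \<Longrightarrow> vanishes (m * n) P (g ^ n)"
  by (induction n) (auto dest: vanishes_mult)

lemma vanishes_mult_left: "vanishes m P h \<Longrightarrow> vanishes m P (g * h)"
  by (simp add: vanishes_def blowup.hom_mult)

lemma vanishes_mono: "vanishes n P g \<Longrightarrow> m \<le> n \<Longrightarrow> vanishes m P g"
  by (auto simp: vanishes_coeff_iff)

lemma vanishes_1_iff: "vanishes 1 P g \<longleftrightarrow> poly2 g P = 0"
proof -
  have "poly2 (blowup P g) (0, 0) = poly2 g P" by (simp add: poly2_blowup)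
  then show ?thesis
    by (simp add: vanishes_coeff_iff poly2_def poly_0_coeff_0)
qed

lemma mult_at_eq_0_iff: "g \<noteq> 0 \<Longrightarrow> mult_at P g = 0 \<longleftrightarrow> poly2 g P \<noteq> 0"
  for g :: "'a::field_char_0 poly poly"
  using vanishes_iff_mult_at[of 1 P g] vanishes_1_iff[of P g] by (auto simp: Suc_le_eq)

section \<open>Bezout's inequality\<close>

lemma finite_triangle [simp]: "finite {(i::nat, j). i + j < n}"
  by (rule finite_subset[of _ "{..<n} \<times> {..<n}"]) auto

lemma card_triangle: "2 * card {(i::nat, j). i + j < n} = n * (n + 1)"
proof (induction n)
  case (Suc n)
  have "{(i::nat, j). i + j < Suc n} = {(i, j). i + j < n} \<union> (\<lambda>i. (i, n - i)) ` {..n}"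
    by (auto simp: image_iff)
  moreover have "card ({(i, j). i + j < n} \<union> (\<lambda>i. (i, n - i)) ` {..n})
      = card {(i::nat, j). i + j < n} + card ((\<lambda>i. (i, n - i)) ` {..n})"
    by (rule card_Un_disjoint) auto
  moreover have "card ((\<lambda>i. (i, n - i)) ` {..n}) = Suc n"
    by (subst card_image) (auto simp: inj_on_def)
  ultimately show ?case using Suc.IH by simp
qed simp

lemma finite_triangle_flip [simp]: "finite {(k::nat, j). j \<le> k \<and> k < n}"
  by (rule finite_subset[of _ "{..<n} \<times> {..<n}"]) auto

lemma card_triangle_flip: "card {(k::nat, j). j \<le> k \<and> k < n} = card {(i::nat, j). i + j < n}"
  by (rule card_bij_eq[of "\<lambda>(k, j). (k - j, j)" _ _ "\<lambda>(i, j). (i + j, j)"])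
     (auto simp: inj_on_def)

text \<open>The pairs with \<open>i\<close> at least \<open>d\<close> form a translate of the
  smaller triangle. The strip counts the polynomials that are reduced modulo a polynomial of degree
  \<open>d\<close> in \<open>y\<close>.\<close>

lemma card_strip:
  "card {(i::nat, j). i + j < n + d \<and> i < d} + card {(i::nat, j). i + j < n} = card {(i::nat, j). i + j < n + d}"
proof -
  have "{(i::nat, j). i + j < n + d} = {(i, j). i + j < n + d \<and> i < d} \<union> (\<lambda>(i, j). (i + d, j)) ` {(i, j). i + j < n}"
    (is "?L = ?R")
  proof (intro equalityI subsetI)
    fix t assume "t \<in> ?L"
    then show "t \<in> ?R"
      by (cases "fst t < d") (auto simp: split_beta intro!: image_eqI[of _ _ "(fst t - d, snd t)"])
  qed auto
  moreover have "card ({(i, j). i + j < n + d \<and> i < d} \<union> (\<lambda>(i, j). (i + d, j)) ` {(i, j). i + j < n})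
      = card {(i::nat, j). i + j < n + d \<and> i < d} + card ((\<lambda>(i, j). (i + d, j)) ` {(i::nat, j). i + j < n})"
    by (rule card_Un_disjoint) (auto intro: finite_subset[OF _ finite_triangle[of "n + d"]])
  moreover have "card ((\<lambda>(i, j). (i + d, j)) ` {(i::nat, j). i + j < n}) = card {(i::nat, j). i + j < n}"
    by (rule card_image) (auto simp: inj_on_def)
  ultimately show ?thesis by simp
qed

lemma coeff_bmonom_sum:
  assumes "finite S"
  shows "coeff (coeff (\<Sum>s\<in>S. const2 (c s) * bmonom (fst s) (snd s)) i) j = (if (i, j) \<in> S then c (i, j) else 0)"
proof -
  have "coeff (coeff (\<Sum>s\<in>S. const2 (c s) * bmonom (fst s) (snd s)) i) j
      = (\<Sum>s\<in>S. if s = (i, j) then c s else 0)"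
    unfolding coeff_sum by (rule sum.cong) (auto simp: coeff_const2_mult bmonom_def)
  then show ?thesis using assms by simp
qed

definition sep_line :: "'a::comm_ring_1 \<times> 'a \<Rightarrow> 'a \<times> 'a \<Rightarrow> 'a poly poly" where
  "sep_line P Q = (if fst P \<noteq> fst Q then bmonom 0 1 - const2 (fst Q) else bmonom 1 0 - const2 (snd Q))"

lemma sep_line:
  "tdeg (sep_line P Q) \<le> 1" "poly2 (sep_line P Q) Q = 0" "P \<noteq> Q \<Longrightarrow> poly2 (sep_line P Q) P \<noteq> 0"
  using tdeg_bmonom[of 1 0] tdeg_bmonom[of 0 1]
  by (auto simp: sep_line_def poly2_bmonom prod_eq_iff intro!: tdeg_diff_le)

definition local_monom :: "'a::comm_ring_1 \<times> 'a \<Rightarrow> nat \<Rightarrow> nat \<Rightarrow> 'a poly poly" where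
  "local_monom P i j = (bmonom 0 1 - const2 (fst P)) ^ i * (bmonom 1 0 - const2 (snd P)) ^ j"

lemma tdeg_local_monom: "tdeg (local_monom P i j) \<le> i + j"
  unfolding local_monom_def using tdeg_bmonom[of 1 0] tdeg_bmonom[of 0 1]
  by (intro tdeg_mult_le tdeg_power_le[of _ 1, simplified] tdeg_diff_le) auto

lemma blowup_local_monom: "blowup P (local_monom P i j) = bmonom (i + j) j"
proof -
  have "blowup P (bmonom 0 1 - const2 (fst P)) = monom 1 1"
    "blowup P (bmonom 1 0 - const2 (snd P)) = monom (monom 1 1) 1"
    by (simp_all add: blowup.hom_minus blowup_bmonom) (simp_all add: const2_def monom_Suc monom_0)
  then show ?thesis
    by (simp add: local_monom_def blowup.hom_mult blowup.hom_power monom_power mult_monom bmonom_def)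
qed

text \<open>The blowup at \<open>P\<close> turns the local monomials of degree below
  \<open>m\<close> into different monomials of order below \<open>m\<close> in \<open>t\<close>, so
  they cannot cancel.\<close>

lemma local_monom_independent:
  assumes "vanishes m P (\<Sum>s\<in>{(i, j). i + j < m}. const2 (c s) * local_monom P (fst s) (snd s))"
    and "i + j < m"
  shows "c (i, j) = 0"
proof -
  let ?u = "\<Sum>s\<in>{(i, j). i + j < m}. const2 (c s) * local_monom P (fst s) (snd s)"
  have "0 = coeff (coeff (blowup P ?u) (i + j)) j"
    using assms by (simp add: vanishes_coeff_iff)
  also have "\<dots> = (\<Sum>s\<in>{(i, j). i + j < m}. if s = (i, j) then c s else 0)"
    unfolding blowup.hom_sum coeff_sum
    by (rule sum.cong) (auto simp: blowup.hom_mult blowup_local_monom coeff_const2_mult bmonom_def)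
  also have "\<dots> = c (i, j)" using assms(2) by simp
  finally show ?thesis by simp
qed

text \<open>If the inequality fails, then for large \<open>n\<close> the equation \<open>f A + g B + \<Sum> \<xi> q = 0\<close> in degree \<open>n\<close> has more unknowns
  than equations. Here \<open>deg\<^sub>y B < deg f\<close>, \<open>B\<close> has multiplicity at least \<open>m\<^sub>P - 1\<close> at every \<open>P\<close>, and the
  \<open>q\<close> have linearly independent jets of order \<open>m\<^sub>P\<close>. Comparing jets yields \<open>\<xi> = 0\<close>, so \<open>f\<close> divides \<open>g B\<close>,
  hence \<open>B\<close>, and the solution is trivial.\<close>

lemma bezout:
  fixes f g :: "'a::field_char_0 poly poly"
  assumes irr: "irreducible f" and monic: "degree f = tdeg f" and W: "finite W"
    and g: "tdeg g \<le> e" "\<And>P. P \<in> W \<Longrightarrow> poly2 g P = 0" and ndvd: "\<not> f dvd g"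
  shows "(\<Sum>P\<in>W. mult_at P f) \<le> tdeg f * e"
proof (rule ccontr)
  define m where "m P = mult_at P f" for P
  define d where "d = tdeg f"
  define k where "k = (\<Sum>P\<in>W. m P)"
  \<comment> \<open>Large enough for \<open>d\<close> and \<open>e\<close> to be subtracted and for
    the products of \<open>q P\<close> with local monomials, of degree at most \<open>2 * k\<close>,
    to fit.\<close>
  define n where "n = d + e + 2 * k"
  assume "\<not> ?thesis"
  then have less: "d * e < k" by (simp add: k_def m_def d_def)
  have f0: "f \<noteq> 0" using irr by auto
  have prime: "prime_elem f" using irr by simp
  have mle: "m P \<le> k" if "P \<in> W" for P
    unfolding k_def using member_le_sum[OF that, of m] W by simp
  have "d \<noteq> 0"
  proof
    assume "d = 0"
    then have "k = 0" using mult_at_le_tdeg[OF f0] by (simp add: k_def m_def d_def)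
    then show False using less by simp
  qed
  \<comment> \<open>\<open>q P\<close> isolates \<open>P\<close>: it is nonzero there and vanishes
    to the order \<open>m Q\<close> at every other point \<open>Q\<close> of
    \<open>W\<close>.\<close>
  define q where "q P = (\<Prod>Q\<in>W - {P}. sep_line P Q ^ m Q)" for P
  have tdeg_q: "tdeg (q P) \<le> k" for P
  proof -
    have "tdeg (q P) \<le> (\<Sum>Q\<in>W - {P}. m Q)"
      unfolding q_def by (intro tdeg_prod_le tdeg_power_le[of _ 1, unfolded mult_1_left] sep_line)
    also have "\<dots> \<le> k" unfolding k_def by (intro sum_mono2 W) auto
    finally show ?thesis .
  qed
  have q_at: "poly2 (q P) P \<noteq> 0" for P
    using W sep_line(3)[of P] by (auto simp: q_def poly2_prod)
  have q_van: "vanishes (m Q) Q (q P)" if "Q \<in> W" "Q \<noteq> P" for P Q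
  proof -
    have "q P = (\<Prod>R\<in>W - {P} - {Q}. sep_line P R ^ m R) * sep_line P Q ^ m Q"
      unfolding q_def using W that by (subst prod.remove[of _ Q]) auto
    moreover have "vanishes (m Q) Q (sep_line P Q ^ m Q)"
      using vanishes_power[of 1 Q "sep_line P Q" "m Q"] by (simp add: vanishes_1_iff[simplified] sep_line)
    ultimately show ?thesis by (simp add: vanishes_mult_left)
  qed

  \<comment> \<open>Unknowns: \<open>SA\<close> and \<open>SB\<close> index the coefficients of
    \<open>A\<close> and \<open>B\<close>, and \<open>SX\<close> those of the local jets. Equations:
    \<open>TA\<close> for the coefficients of the relation up to degree \<open>n\<close>, and
    \<open>TX\<close> for the vanishing of \<open>B\<close> to order \<open>m P - 1\<close>. If
    \<open>m P = 0\<close>, the truncated difference gives no condition, in agreement with the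
    count.\<close>
  define SA where "SA = {(i::nat, j). i + j < n - d + 1}"
  define SB where "SB = {(i::nat, j). i + j < n - e + 1 \<and> i < d}"
  define SX where "SX = Sigma W (\<lambda>P. {(i::nat, j). i + j < m P})"
  define TX where "TX = Sigma W (\<lambda>P. {(k::nat, j). j \<le> k \<and> k < m P - 1})"
  define TA where "TA = {(i::nat, j). i + j < n + 1}"
  define S where "S = (SA <+> SB) <+> SX"
  define T where "T = TA <+> TX"
  have fin: "finite SA" "finite SB" "finite SX" "finite TA" "finite TX"
    using W unfolding SA_def SB_def SX_def TA_def TX_def
    by (auto simp del: One_nat_def intro: finite_subset[OF _ finite_triangle[of "n - e + 1"]] finite_triangle_flip)
  define w where "w s = (case s of Inl (Inl t) \<Rightarrow> f * bmonom (fst t) (snd t)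
      | Inl (Inr t) \<Rightarrow> g * bmonom (fst t) (snd t)
      | Inr (P, t) \<Rightarrow> q P * local_monom P (fst t) (snd t))" for s
  define b where "b s = (case s of Inl (Inr t) \<Rightarrow> bmonom (fst t) (snd t) | _ \<Rightarrow> (0 :: 'a poly poly))"
    for s :: "(nat \<times> nat + nat \<times> nat) + ('a \<times> 'a) \<times> nat \<times> nat"
  define M where "M t s = (case t of Inl (i, j) \<Rightarrow> coeff (coeff (w s) i) j
      | Inr (P, l, j) \<Rightarrow> coeff (coeff (blowup P (b s)) l) j)" for t s
  have "card T < card S"
  proof -
    \<comment> \<open>With \<open>r = n - d - e + 1\<close> the numbers of monomials combine so that
      unknowns exceed equations by exactly \<open>k - d * e\<close>.\<close>
    define r where "r = 2 * k + 1"
    have "card SA = card {(i::nat, j). i + j < r + e}" by (simp add: SA_def n_def r_def algebra_simps)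
    moreover have "card SB + card {(i::nat, j). i + j < r} = card {(i::nat, j). i + j < r + d}"
      using card_strip[of r d] by (simp add: SB_def n_def r_def algebra_simps)
    moreover have "card TA = card {(i::nat, j). i + j < r + d + e}"
      by (simp add: TA_def n_def r_def algebra_simps)
    moreover have "card SX = card TX + k"
    proof -
      have "card SX = (\<Sum>P\<in>W. card {(i::nat, j). i + j < m P})"
        using W by (simp add: SX_def card_SigmaI)
      also have "\<dots> = (\<Sum>P\<in>W. card {(k::nat, j). j \<le> k \<and> k < m P - 1} + m P)"
      proof (rule sum.cong)
        fix P
        show "card {(i::nat, j). i + j < m P} = card {(k::nat, j). j \<le> k \<and> k < m P - 1} + m P"
          unfolding card_triangle_flip using card_triangle[of "m P"] card_triangle[of "m P - 1"]
          by (cases "m P") (simp_all add: algebra_simps)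
      qed simp
      also have "\<dots> = card TX + k"
        using W by (simp add: TX_def card_SigmaI sum.distrib k_def del: One_nat_def)
      finally show ?thesis .
    qed
    moreover have "card {(i::nat, j). i + j < r + d + e} + card {(i::nat, j). i + j < r}
        = card {(i::nat, j). i + j < r + e} + card {(i::nat, j). i + j < r + d} + d * e"
      using card_triangle[of "r + d + e"] card_triangle[of r] card_triangle[of "r + e"] card_triangle[of "r + d"]
      by (simp add: algebra_simps)
    ultimately show ?thesis
      using less fin by (simp add: S_def T_def card_Plus)
  qed
  moreover have "finite S" "finite T" using fin by (auto simp: S_def T_def)
  ultimately obtain x where x: "\<exists>s\<in>S. x s \<noteq> 0" "\<forall>t\<in>T. (\<Sum>s\<in>S. x s * M t s) = 0"
    using nontrivial_solution[of T S M] by blast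
  define A where "A = (\<Sum>t\<in>SA. const2 (x (Inl (Inl t))) * bmonom (fst t) (snd t))"
  define B where "B = (\<Sum>t\<in>SB. const2 (x (Inl (Inr t))) * bmonom (fst t) (snd t))"
  define u where "u P = (\<Sum>t\<in>{(i, j). i + j < m P}. const2 (x (Inr (P, t))) * local_monom P (fst t) (snd t))" for P
  have sumS: "(\<Sum>s\<in>S. h s) = (\<Sum>t\<in>SA. h (Inl (Inl t))) + (\<Sum>t\<in>SB. h (Inl (Inr t)))
      + (\<Sum>P\<in>W. \<Sum>t\<in>{(i, j). i + j < m P}. h (Inr (P, t)))" for h :: "_ \<Rightarrow> 'a poly poly"
    unfolding S_def using fin W
    by (simp add: sum.Plus SX_def sum.Sigma)
  have V: "(\<Sum>s\<in>S. const2 (x s) * w s) = f * A + g * B + (\<Sum>P\<in>W. q P * u P)"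
    unfolding sumS A_def B_def u_def by (simp add: w_def sum_distrib_left mult_ac)
  have Bsum: "(\<Sum>s\<in>S. const2 (x s) * b s) = B"
    unfolding sumS B_def by (simp add: b_def)
  have "f * A + g * B + (\<Sum>P\<in>W. q P * u P) = 0"
  proof (rule poly_eqI, rule poly_eqI)
    fix i j
    show "coeff (coeff (f * A + g * B + (\<Sum>P\<in>W. q P * u P)) i) j = coeff (coeff 0 i) j"
    proof (cases "i + j \<le> n")
      case True
      then have "Inl (i, j) \<in> T" by (auto simp: T_def TA_def)
      then have "(\<Sum>s\<in>S. x s * M (Inl (i, j)) s) = 0" using x(2) by blast
      then show ?thesis
        unfolding V[symmetric] by (simp add: M_def coeff_sum coeff_const2_mult)
    next
      case False
      have "tdeg (w s) \<le> n" if "s \<in> S" for s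
      proof -
        have "tdeg (f * bmonom i j) \<le> n" if "i + j \<le> n - d" for i j
        proof -
          have "tdeg (f * bmonom i j) \<le> d + (n - d)"
            by (rule tdeg_mult_le) (use that tdeg_bmonom[of i j, where 'a = 'a] in \<open>auto simp: d_def\<close>)
          then show ?thesis by (simp add: n_def)
        qed
        moreover have "tdeg (g * bmonom i j) \<le> n" if "i + j \<le> n - e" for i j
        proof -
          have "tdeg (g * bmonom i j) \<le> e + (n - e)"
            by (rule tdeg_mult_le) (use that g(1) tdeg_bmonom[of i j, where 'a = 'a] in auto)
          then show ?thesis by (simp add: n_def)
        qed
        moreover have "tdeg (q P * local_monom P i j) \<le> n" if "P \<in> W" "i + j < m P" for P i j
        proof -
          have "tdeg (q P * local_monom P i j) \<le> k + k"
            by (rule tdeg_mult_le[OF tdeg_q]) (use that tdeg_local_monom[of P i j] mle[of P] in auto)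
          then show ?thesis by (simp add: n_def)
        qed
        ultimately show ?thesis using that
          by (auto simp: S_def SA_def SB_def SX_def w_def)
      qed
      then have "tdeg (\<Sum>s\<in>S. const2 (x s) * w s) \<le> n"
        using \<open>finite S\<close> by (intro tdeg_sum_le) (auto intro: tdeg_mult_le[of _ 0, simplified])
      then show ?thesis using False unfolding V tdeg_le_iff by simp
    qed
  qed
  then have eq: "f * A + g * B = - (\<Sum>P\<in>W. q P * u P)" by (simp add: eq_neg_iff_add_eq_0)
  have B_van: "vanishes (m P - 1) P B" if "P \<in> W" for P
    unfolding vanishes_coeff_iff
  proof (intro allI impI)
    fix l j assume "l < m P - 1" "j \<le> l"
    then have "Inr (P, l, j) \<in> T" using that by (auto simp: T_def TX_def)
    then have "(\<Sum>s\<in>S. x s * M (Inr (P, l, j)) s) = 0" using x(2) by blast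
    then show "coeff (coeff (blowup P B) l) j = 0"
      unfolding Bsum[symmetric]
      by (simp add: M_def coeff_sum coeff_const2_mult blowup.hom_sum blowup.hom_mult)
  qed
  \<comment> \<open>At \<open>P\<close> every term except \<open>q P * u P\<close> has order at
    least \<open>m P\<close>: the zero of \<open>g\<close> supplies the order that \<open>B\<close>
    lacks. Since \<open>q P\<close> does not vanish at \<open>P\<close>, the jet \<open>u P\<close>
    must be zero.\<close>
  have u0: "x (Inr (P, i, j)) = 0" if P: "P \<in> W" and ij: "i + j < m P" for P i j
  proof -
    have "vanishes (m P) P (f * A + g * B)"
    proof (rule vanishes_add)
      show "vanishes (m P) P (f * A)"
        using vanishes_mult_left[of "m P" P f A] vanishes_iff_mult_at[of "m P" P f]
        by (simp add: m_def mult.commute)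
      have "vanishes (1 + (m P - 1)) P (g * B)"
        by (rule vanishes_mult) (use g(2)[OF P] B_van[OF P] in \<open>auto simp: vanishes_1_iff[simplified]\<close>)
      then show "vanishes (m P) P (g * B)" by (rule vanishes_mono) simp
    qed
    moreover have "vanishes (m P) P (\<Sum>Q\<in>W - {P}. q Q * u Q)"
      by (rule vanishes_sum) (use q_van[OF P] in \<open>auto simp: mult.commute[of "q _"] intro!: vanishes_mult_left\<close>)
    moreover have "q P * u P = - (f * A + g * B) - (\<Sum>Q\<in>W - {P}. q Q * u Q)"
      unfolding eq using W P by (simp add: sum.remove[of W P])
    ultimately have "vanishes (m P) P (q P * u P)"
      using vanishes_diff[of "m P" P 0 "f * A + g * B"] vanishes_diff[of "m P" P "- (f * A + g * B)"]
      by (simp add: vanishes_def)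
    moreover have "q P \<noteq> 0" using q_at[of P] by auto
    moreover have "mult_at P (q P) = 0" using q_at \<open>q P \<noteq> 0\<close> by (simp add: mult_at_eq_0_iff)
    ultimately have "vanishes (m P) P (u P)"
      by (cases "u P = 0") (auto simp: vanishes_iff_mult_at mult_at_mult)
    then show ?thesis
      unfolding u_def by (rule local_monom_independent[of _ _ "\<lambda>t. x (Inr (P, t))", OF _ ij])
  qed
  then have "u P = 0" if "P \<in> W" for P
    using that unfolding u_def by (intro sum.neutral) auto
  then have fgAB: "f * A + g * B = 0" using eq by simp
  then have "f dvd g * B"
    by (metis dvd_add_right_iff dvd_0_right dvd_triv_left)
  then have "f dvd B" using prime ndvd by (simp add: prime_elem_dvd_mult_iff)
  \<comment> \<open>The unknowns in \<open>SB\<close> allow only degrees below \<open>d\<close> in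
    \<open>y\<close>, whereas a nonzero multiple of \<open>f\<close> has degree at least
    \<open>d\<close> in \<open>y\<close>.\<close>
  have "B = 0"
  proof (rule ccontr)
    assume "B \<noteq> 0"
    have "coeff B i = 0" if "i \<ge> d" for i
    proof (rule poly_eqI)
      fix j show "coeff (coeff B i) j = coeff 0 j"
        unfolding B_def coeff_bmonom_sum[OF fin(2)] using that by (simp add: SB_def)
    qed
    then have "degree B < d" using \<open>B \<noteq> 0\<close> by (metis leading_coeff_0_iff not_le)
    moreover have "degree f \<le> degree B" using \<open>f dvd B\<close> \<open>B \<noteq> 0\<close> by (rule dvd_imp_degree_le)
    ultimately show False using monic by (simp add: d_def)
  qed
  moreover have "A = 0" using fgAB \<open>B = 0\<close> f0 by simp
  ultimately have "x (Inl (Inl t)) = 0" if "t \<in> SA" for t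
    using coeff_bmonom_sum[OF fin(1), of "\<lambda>t. x (Inl (Inl t))" "fst t" "snd t"] that
    by (simp add: A_def[symmetric])
  moreover have "x (Inl (Inr t)) = 0" if "t \<in> SB" for t
    using coeff_bmonom_sum[OF fin(2), of "\<lambda>t. x (Inl (Inr t))" "fst t" "snd t"] that \<open>B = 0\<close>
    by (simp add: B_def[symmetric])
  ultimately have "\<forall>s\<in>S. x s = 0" using u0 by (auto simp: S_def SX_def)
  then show False using x(1) by blast
qed

section \<open>Curves through separated points\<close>

text \<open>Up to a scalar \<open>g\<close> is monic in \<open>y\<close> with its total degree as
  exponent: the vertical point at infinity is off the curve. This is the normalisation that Bezout's
  inequality asks for.\<close>

definition ymonic :: "'a::comm_ring_1 poly poly \<Rightarrow> bool" where
  "ymonic g \<longleftrightarrow> g \<noteq> 0 \<and> degree g = tdeg g"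

text \<open>Both degrees are additive and one bounds the other, so equality for a product forces
  equality for each factor.\<close>

lemma ymonic_mult_iff: "ymonic (g * h) \<longleftrightarrow> ymonic g \<and> ymonic h"
  for g h :: "'a::field_char_0 poly poly"
proof (cases "g = 0 \<or> h = 0")
  case False
  then show ?thesis
    using degree_le_tdeg[of g] degree_le_tdeg[of h]
    by (auto simp: ymonic_def tdeg_mult degree_mult_eq)
qed (auto simp: ymonic_def)

lemma tdeg_0_imp_const2: "tdeg g = 0 \<Longrightarrow> g = const2 (coeff (coeff g 0) 0)"
  using tdeg_le_iff[of g 0]
  by (auto intro!: poly_eqI simp: const2_def coeff_pCons split: nat.split)

text \<open>Passage from irreducible components to the whole curve, for \<open>\<Phi>\<close> a
  weighted sum of multiplicities. Factors inherit \<open>ymonic\<close>, which makes the induction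
  on the degree possible.\<close>

lemma ymonic_induct_bound:
  fixes \<Phi> :: "'a::field_char_0 poly poly \<Rightarrow> nat"
  assumes "ymonic F"
    and mult: "\<And>g h. g \<noteq> 0 \<Longrightarrow> h \<noteq> 0 \<Longrightarrow> \<Phi> (g * h) = \<Phi> g + \<Phi> h"
    and const: "\<And>g. g \<noteq> 0 \<Longrightarrow> tdeg g = 0 \<Longrightarrow> \<Phi> g = 0"
    and irred: "\<And>f. irreducible f \<Longrightarrow> ymonic f \<Longrightarrow> \<Phi> f \<le> n * tdeg f"
  shows "\<Phi> F \<le> n * tdeg F"
  using assms(1)
proof (induction "tdeg F" arbitrary: F rule: less_induct)
  case less
  have F0: "F \<noteq> 0" using less.prems by (simp add: ymonic_def)
  consider "tdeg F = 0" | "irreducible F" | "tdeg F \<noteq> 0" "\<not> irreducible F" by blast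
  then show ?case
  proof cases
    case 3
    have "\<not> F dvd 1"
    proof
      assume "F dvd 1"
      then obtain H where H: "1 = F * H" by blast
      then have "H \<noteq> 0" by auto
      then have "tdeg F + tdeg H = 0" using tdeg_mult[OF F0 \<open>H \<noteq> 0\<close>] H by (metis tdeg_simps(2))
      then show False using 3 by simp
    qed
    then obtain A B where AB: "F = A * B" "\<not> A dvd 1" "\<not> B dvd 1"
      using 3 F0 unfolding irreducible_def by blast
    have "A \<noteq> 0" "B \<noteq> 0" using F0 AB by auto
    \<comment> \<open>A nonzero polynomial of total degree zero is a constant and thus a
      unit.\<close>
    have pos: "tdeg C \<noteq> 0" if "C \<noteq> 0" "\<not> C dvd 1" for C :: "'a poly poly"
    proof
      assume "tdeg C = 0"
      then have C: "C = const2 (coeff (coeff C 0) 0)" by (rule tdeg_0_imp_const2)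
      then have "coeff (coeff C 0) 0 \<noteq> 0" using that(1) by auto
      then have "1 = const2 (coeff (coeff C 0) 0) * const2 (inverse (coeff (coeff C 0) 0))"
        unfolding const2_simps(4)[symmetric] by simp
      with C have "C dvd 1" by (metis dvd_triv_left)
      with that show False by simp
    qed
    have td: "tdeg F = tdeg A + tdeg B" using AB \<open>A \<noteq> 0\<close> \<open>B \<noteq> 0\<close> by (simp add: tdeg_mult)
    have "ymonic A" "ymonic B" using less.prems AB by (simp_all add: ymonic_mult_iff)
    moreover have "tdeg A < tdeg F" "tdeg B < tdeg F"
      using td pos[of A] pos[of B] AB \<open>A \<noteq> 0\<close> \<open>B \<noteq> 0\<close> by auto
    ultimately have "\<Phi> A \<le> n * tdeg A" "\<Phi> B \<le> n * tdeg B" using less.hyps by auto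
    then show ?thesis
      using td AB \<open>A \<noteq> 0\<close> \<open>B \<noteq> 0\<close> by (simp add: mult distrib_left)
  qed (use F0 const irred less.prems in auto)
qed

section \<open>Lines and collinearity\<close>

definition line :: "'a::comm_ring_1 \<times> 'a \<Rightarrow> 'a \<times> 'a \<Rightarrow> 'a poly poly" where
  "line P Q = const2 (snd Q - snd P) * (bmonom 0 1 - const2 (fst P))
            - const2 (fst Q - fst P) * (bmonom 1 0 - const2 (snd P))"

text \<open>For \<open>P = Q\<close> the line polynomial is zero and every \<open>R\<close> counts
  as collinear, so distinctness is demanded wherever an actual line is meant.\<close>

definition collin :: "'a::comm_ring_1 \<times> 'a \<Rightarrow> 'a \<times> 'a \<Rightarrow> 'a \<times> 'a \<Rightarrow> bool" where
  "collin P Q R \<longleftrightarrow> poly2 (line P Q) R = 0"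

lemma tdeg_line: "tdeg (line P Q) \<le> 1"
proof -
  have "tdeg (bmonom 0 1 :: 'a poly poly) \<le> 1" "tdeg (bmonom 1 0 :: 'a poly poly) \<le> 1"
    using tdeg_bmonom[of 1 0] tdeg_bmonom[of 0 1] by auto
  then show ?thesis unfolding line_def
    by (intro tdeg_diff_le tdeg_mult_le[of _ 0 _ 1, unfolded add_0]) auto
qed

lemma collin_iff: "collin P Q R \<longleftrightarrow>
    (snd Q - snd P) * (fst R - fst P) = (fst Q - fst P) * (snd R - snd P)"
  by (simp add: collin_def line_def poly2_bmonom)

lemma line_nonzero: "P \<noteq> Q \<Longrightarrow> line P Q \<noteq> 0" for P :: "'a::idom \<times> 'a"
proof
  assume "P \<noteq> Q" "line P Q = 0"
  then have "collin P Q R" for R by (simp add: collin_def)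
  from this[of "(fst P + 1, snd P)"] this[of "(fst P, snd P + 1)"] show False
    using \<open>P \<noteq> Q\<close> by (auto simp: collin_iff prod_eq_iff)
qed

lemma collin_refl [simp]: "collin P Q P" "collin P Q Q"
  by (simp_all add: collin_iff)

lemma collin_swap12: "collin P Q R \<longleftrightarrow> collin Q P R" and collin_swap23: "collin P Q R \<longleftrightarrow> collin P R Q"
  for P :: "'a::idom \<times> 'a"
proof -
  have "(snd Q - snd P) * (fst R - fst P) - (fst Q - fst P) * (snd R - snd P)
      = - ((snd P - snd Q) * (fst R - fst Q) - (fst P - fst Q) * (snd R - snd Q))"
    by (simp add: algebra_simps)
  then show "collin P Q R \<longleftrightarrow> collin Q P R"
    unfolding collin_iff eq_iff_diff_eq_0[of "_ * _"] by (metis neg_equal_0_iff_equal)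
  have "(snd Q - snd P) * (fst R - fst P) - (fst Q - fst P) * (snd R - snd P)
      = - ((snd R - snd P) * (fst Q - fst P) - (fst R - fst P) * (snd Q - snd P))"
    by (simp add: algebra_simps)
  then show "collin P Q R \<longleftrightarrow> collin P R Q"
    unfolding collin_iff eq_iff_diff_eq_0[of "_ * _"] by (metis neg_equal_0_iff_equal)
qed

lemma collin_join:
  fixes P :: "'a::idom \<times> 'a"
  assumes "P \<noteq> Q" "collin P Q R" "collin P Q S"
  shows "collin P R S"
proof -
  \<comment> \<open>Both \<open>(r, r')\<close> and \<open>(s, s')\<close> are proportional to
    \<open>(u, v)\<close>. Multiplying their determinant by \<open>u\<close> and by \<open>v\<close>
    avoids division.\<close>
  have "u = 0 \<and> v = 0 \<or> r' * s = r * s'" if "v * r = u * r'" "v * s = u * s'" for u v r r' s s' :: 'a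
  proof -
    have "v * (r' * s) = r' * (v * s)" by (rule mult.left_commute)
    also have "\<dots> = s' * (u * r')" unfolding that(2) by (simp only: mult_ac)
    also have "\<dots> = v * (r * s')" unfolding that(1)[symmetric] by (simp only: mult_ac)
    finally have 1: "v * (r' * s) = v * (r * s')" .
    have "u * (r' * s) = s * (u * r')" by (simp only: mult_ac)
    also have "\<dots> = r * (v * s)" unfolding that(1)[symmetric] by (simp only: mult_ac)
    also have "\<dots> = u * (r * s')" unfolding that(2) by (simp only: mult_ac)
    finally have 2: "u * (r' * s) = u * (r * s')" .
    show ?thesis using 1 2 unfolding mult_cancel_left by blast
  qed
  from this[OF assms(2,3)[unfolded collin_iff]] show ?thesis
    using assms(1) unfolding collin_iff prod_eq_iff by (metis eq_iff_diff_eq_0)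
qed

text \<open>Either Bezout's inequality applies to \<open>f\<close> and the line, or \<open>f\<close>
  divides the line and is that line itself. The second alternative records what is needed to check a
  weighted inequality on the line directly.\<close>

lemma bezout_line:
  fixes f :: "'a::field_char_0 poly poly"
  assumes f: "irreducible f" "ymonic f" and "P \<noteq> Q"
    and As: "distinct As" "\<forall>R\<in>set As. collin P Q R"
  shows "(\<Sum>R\<leftarrow>As. mult_at R f) \<le> tdeg f
    \<or> tdeg f = 1 \<and> (\<forall>R. mult_at R f \<le> 1) \<and> (\<forall>R. \<not> collin P Q R \<longrightarrow> mult_at R f = 0)"
proof (cases "f dvd line P Q")
  case True
  have l0: "line P Q \<noteq> 0" using assms(3) by (rule line_nonzero)
  then obtain h where h: "line P Q = f * h" "f \<noteq> 0" "h \<noteq> 0" using True by auto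
  then have le: "tdeg f \<le> 1" using tdeg_mult[OF h(2,3)] tdeg_line[of P Q] by simp
  have "tdeg f \<noteq> 0"
  proof
    assume "tdeg f = 0"
    then have C: "f = const2 (coeff (coeff f 0) 0)" by (rule tdeg_0_imp_const2)
    then have "coeff (coeff f 0) 0 \<noteq> 0" using h(2) by auto
    then have "1 = const2 (coeff (coeff f 0) 0) * const2 (inverse (coeff (coeff f 0) 0))"
      unfolding const2_simps(4)[symmetric] by simp
    with C have "f dvd 1" by (metis dvd_triv_left)
    with f(1) show False by (simp add: irreducible_def)
  qed
  with le have 1: "tdeg f = 1" by simp
  moreover have "mult_at R f = 0" if "\<not> collin P Q R" for R
    using that h by (auto simp: collin_def mult_at_eq_0_iff)
  moreover have "mult_at R f \<le> 1" for R using mult_at_le_tdeg[OF h(2), of R] 1 by simp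
  ultimately show ?thesis by blast
next
  case False
  then have "(\<Sum>R\<in>set As. mult_at R f) \<le> tdeg f"
    using bezout[OF f(1) _ _ tdeg_line _ False, of "set As"] f(2) As by (simp add: ymonic_def collin_def)
  then show ?thesis using As by (simp add: sum_list_distinct_conv_sum_set)
qed

text \<open>Over a field this says that the evaluations at the points of \<open>W\<close> are
  linearly independent on polynomials of degree at most \<open>e\<close>.\<close>

definition separated :: "nat \<Rightarrow> ('a::comm_ring_1 \<times> 'a) set \<Rightarrow> bool" where
  "separated e W \<longleftrightarrow> (\<forall>w\<in>W. \<exists>g. tdeg g \<le> e \<and> poly2 g w \<noteq> 0 \<and> (\<forall>v\<in>W - {w}. poly2 g v = 0))"

text \<open>A curve through \<open>w\<close> cannot divide the separator of \<open>w\<close>, so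
  Bezout's inequality applies to the two at the remaining points.\<close>

lemma separated_bound:
  fixes f :: "'a::field_char_0 poly poly"
  assumes f: "irreducible f" "ymonic f" and W: "finite W" "separated e W" "w \<in> W" "mult_at w f \<noteq> 0"
  shows "(\<Sum>v\<in>W - {w}. mult_at v f) \<le> e * tdeg f"
proof -
  obtain g where g: "tdeg g \<le> e" "poly2 g w \<noteq> 0" "\<forall>v\<in>W - {w}. poly2 g v = 0"
    using W unfolding separated_def by blast
  have "\<not> f dvd g"
  proof
    assume "f dvd g"
    then have "poly2 f w \<noteq> 0" using g(2) by auto
    then have "mult_at w f = 0" using f by (auto simp: mult_at_eq_0_iff ymonic_def)
    with W show False by simp
  qed
  with bezout[OF f(1) _ _ g(1) _ this, of "W - {w}"] g W f show ?thesis
    by (auto simp: ymonic_def mult.commute)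
qed

text \<open>The point \<open>w\<close> left out by \<open>separated_bound\<close> adds at most the
  degree of \<open>f\<close>.\<close>

lemma separated_total_bound:
  fixes f :: "'a::field_char_0 poly poly"
  assumes f: "irreducible f" "ymonic f" and W: "finite W" "separated e W"
  shows "(\<Sum>v\<in>W. mult_at v f) \<le> (e + 1) * tdeg f"
proof (cases "\<exists>w\<in>W. mult_at w f \<noteq> 0")
  case True
  then obtain w where w: "w \<in> W" "mult_at w f \<noteq> 0" by blast
  have "(\<Sum>v\<in>W. mult_at v f) = mult_at w f + (\<Sum>v\<in>W - {w}. mult_at v f)"
    using W w by (simp add: sum.remove)
  also have "\<dots> \<le> tdeg f + e * tdeg f"
    using f by (intro add_mono mult_at_le_tdeg separated_bound W w) (auto simp: ymonic_def)
  finally show ?thesis by simp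
qed simp

text \<open>If \<open>f\<close> meets \<open>w\<close> and another point \<open>a\<close>, then
  \<open>separated_bound\<close> for \<open>a\<close> leaves out \<open>a\<close>, and the line
  through \<open>w\<close> and \<open>a\<close> bounds the multiplicity at \<open>a\<close> together
  with the second copy of that at \<open>w\<close>. If \<open>f\<close> is this line, isolation
  leaves only these two points.\<close>

lemma separated_isolated_bound:
  fixes f :: "'a::field_char_0 poly poly"
  assumes f: "irreducible f" "ymonic f" and W: "finite W" "separated 2 W" "w \<in> W"
    and iso: "\<And>a b. a \<in> W \<Longrightarrow> b \<in> W \<Longrightarrow> a \<noteq> w \<Longrightarrow> collin w a b \<Longrightarrow> b \<in> {w, a}"
  shows "(\<Sum>v\<in>W. mult_at v f) + mult_at w f \<le> 3 * tdeg f"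
proof -
  let ?m = "\<lambda>v. mult_at v f"
  have m_le: "?m v \<le> tdeg f" for v using f by (intro mult_at_le_tdeg) (auto simp: ymonic_def)
  consider "?m w = 0" | "\<forall>a\<in>W - {w}. ?m a = 0" | a where "a \<in> W" "a \<noteq> w" "?m a \<noteq> 0" by blast
  then show ?thesis
  proof cases
    case 1
    then show ?thesis using separated_total_bound[OF f W(1,2)] by simp
  next
    case 2
    then show ?thesis using W m_le[of w] by (simp add: sum.remove)
  next
    case 3
    have split: "(\<Sum>v\<in>W. ?m v) = ?m a + (\<Sum>v\<in>W - {a}. ?m v)"
      using W(1) 3(1) by (rule sum.remove)
    from 3 have "w \<noteq> a" by simp
    with f have "(\<Sum>v\<leftarrow>[w, a]. ?m v) \<le> tdeg f
      \<or> tdeg f = 1 \<and> (\<forall>R. ?m R \<le> 1) \<and> (\<forall>R. \<not> collin w a R \<longrightarrow> ?m R = 0)"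
      by (intro bezout_line) auto
    then show ?thesis
    proof (elim disjE conjE)
      assume *: "tdeg f = 1" "\<forall>R. ?m R \<le> 1" "\<forall>R. \<not> collin w a R \<longrightarrow> ?m R = 0"
      have "?m v = 0" if "v \<in> W" "v \<notin> {w, a}" for v
        using iso[OF 3(1) that(1) 3(2)] that *(3) by blast
      then have "(\<Sum>v\<in>W. ?m v) = (\<Sum>v\<in>{w, a}. ?m v)"
        using W 3 by (intro sum.mono_neutral_right) auto
      moreover have "?m w \<le> 1" "?m a \<le> 1" using *(2) by blast+
      ultimately show ?thesis using \<open>w \<noteq> a\<close> *(1) by simp
    next
      assume "(\<Sum>v\<leftarrow>[w, a]. ?m v) \<le> tdeg f"
      moreover have "(\<Sum>v\<in>W - {a}. ?m v) \<le> 2 * tdeg f" by (rule separated_bound[OF f W(1,2) 3(1,3)])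
      ultimately show ?thesis using split by simp
    qed
  qed
qed

section \<open>Six points not on a conic\<close>

text \<open>Add the inequalities for the lines \<open>p1 p3 p5\<close>, \<open>p2 p3 p4\<close>,
  \<open>p5 p6\<close> and \<open>p4 p6\<close>. The sum even allows weight two at
  \<open>p3\<close>, but that weight would fail when \<open>f\<close> is itself the line
  \<open>p1 p3\<close>.\<close>

lemma triangle_bound:
  fixes f :: "'a::field_char_0 poly poly"
  assumes f: "irreducible f" "ymonic f" and dist: "distinct [p1, p2, p3, p4, p5, p6]"
    and c: "collin p2 p3 p4" "collin p1 p3 p5" "collin p1 p2 p6"
    and nc: "\<not> collin p1 p2 p3" "\<not> collin p4 p5 p6"
  shows "mult_at p1 f + mult_at p2 f + mult_at p3 f + 2 * (mult_at p4 f + mult_at p5 f + mult_at p6 f) \<le> 4 * tdeg f"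
proof -
  let ?m = "\<lambda>v. mult_at v f"
  let ?on = "\<lambda>P Q. tdeg f = 1 \<and> (\<forall>R. ?m R \<le> 1) \<and> (\<forall>R. \<not> collin P Q R \<longrightarrow> ?m R = 0)"
  have d: "p1 \<noteq> p2" "p1 \<noteq> p3" "p1 \<noteq> p5" "p1 \<noteq> p6" "p2 \<noteq> p3" "p2 \<noteq> p4" "p2 \<noteq> p6" "p3 \<noteq> p4" "p3 \<noteq> p5"
    "p4 \<noteq> p5" "p4 \<noteq> p6" "p5 \<noteq> p6"
    using dist by auto
  note swap = collin_swap12 collin_swap23
  \<comment> \<open>Any further incidence with these lines would make \<open>p1, p2, p3\<close> or
    \<open>p4, p5, p6\<close> collinear.\<close>
  have 1: "\<not> collin p1 p3 p2" "\<not> collin p1 p3 p4" "\<not> collin p1 p3 p6"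
    using d c nc collin_join[of p3 p4 p1 p2] collin_join[of p1 p6 p2 p3] by (auto simp: swap)
  have 2: "\<not> collin p2 p3 p1" "\<not> collin p2 p3 p5" "\<not> collin p2 p3 p6"
    using d c nc collin_join[of p3 p5 p1 p2] collin_join[of p2 p6 p1 p3] by (auto simp: swap)
  have 0: "\<not> collin p1 p2 p4" "\<not> collin p1 p2 p5"
    using d c nc collin_join[of p2 p4 p1 p3] collin_join[of p1 p5 p2 p3] by (auto simp: swap)
  have 3: "\<not> collin p5 p6 p1" "\<not> collin p5 p6 p2" "\<not> collin p5 p6 p3" "\<not> collin p5 p6 p4"
    using d c nc 0 1 2 collin_join[of p1 p5 p3 p6] collin_join[of p2 p6 p1 p5] collin_join[of p3 p5 p1 p6]
    by (auto simp: swap)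
  have 4: "\<not> collin p4 p6 p1" "\<not> collin p4 p6 p2" "\<not> collin p4 p6 p3" "\<not> collin p4 p6 p5"
    using d c nc 0 1 2 collin_join[of p1 p6 p2 p4] collin_join[of p2 p4 p3 p6] collin_join[of p3 p4 p2 p6]
    by (auto simp: swap)
  have "?m p1 + ?m p3 + ?m p5 \<le> tdeg f \<or> ?on p1 p3"
    using bezout_line[OF f d(2), of "[p1, p3, p5]"] dist c by (simp add: add.assoc)
  moreover have "?m p2 + ?m p3 + ?m p4 \<le> tdeg f \<or> ?on p2 p3"
    using bezout_line[OF f d(5), of "[p2, p3, p4]"] dist c by (simp add: add.assoc)
  moreover have "?m p5 + ?m p6 \<le> tdeg f \<or> ?on p5 p6"
    using bezout_line[OF f d(12), of "[p5, p6]"] dist by simp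
  moreover have "?m p4 + ?m p6 \<le> tdeg f \<or> ?on p4 p6"
    using bezout_line[OF f d(11), of "[p4, p6]"] dist by simp
  ultimately consider "?on p1 p3" | "?on p2 p3" | "?on p5 p6" | "?on p4 p6"
    | "?m p1 + ?m p3 + ?m p5 \<le> tdeg f" "?m p2 + ?m p3 + ?m p4 \<le> tdeg f"
      "?m p5 + ?m p6 \<le> tdeg f" "?m p4 + ?m p6 \<le> tdeg f"
    by argo
  then show ?thesis
  proof cases
    case 1
    then have "?m p2 = 0" "?m p4 = 0" "?m p6 = 0" "?m p1 \<le> 1" "?m p3 \<le> 1" "?m p5 \<le> 1" "tdeg f = 1"
      using \<open>\<not> collin p1 p3 p2\<close> \<open>\<not> collin p1 p3 p4\<close> \<open>\<not> collin p1 p3 p6\<close> by blast+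
    then show ?thesis by simp
  next
    case 2
    then have "?m p1 = 0" "?m p5 = 0" "?m p6 = 0" "?m p2 \<le> 1" "?m p3 \<le> 1" "?m p4 \<le> 1" "tdeg f = 1"
      using \<open>\<not> collin p2 p3 p1\<close> \<open>\<not> collin p2 p3 p5\<close> \<open>\<not> collin p2 p3 p6\<close> by blast+
    then show ?thesis by simp
  next
    case 3
    then have "?m p1 = 0" "?m p2 = 0" "?m p3 = 0" "?m p4 = 0" "?m p5 \<le> 1" "?m p6 \<le> 1" "tdeg f = 1"
      using \<open>\<not> collin p5 p6 p1\<close> \<open>\<not> collin p5 p6 p2\<close> \<open>\<not> collin p5 p6 p3\<close> \<open>\<not> collin p5 p6 p4\<close> by blast+
    then show ?thesis by simp
  next
    case 4
    then have "?m p1 = 0" "?m p2 = 0" "?m p3 = 0" "?m p5 = 0" "?m p4 \<le> 1" "?m p6 \<le> 1" "tdeg f = 1"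
      using \<open>\<not> collin p4 p6 p1\<close> \<open>\<not> collin p4 p6 p2\<close> \<open>\<not> collin p4 p6 p3\<close> \<open>\<not> collin p4 p6 p5\<close> by blast+
    then show ?thesis by simp
  qed simp
qed

text \<open>\<open>star p12 p13 p14 p23 p24 p34\<close>: the six points are the pairwise intersections of four lines,
  \<open>pij\<close> being the intersection of the lines number \<open>i\<close> and \<open>j\<close>.\<close>

definition star :: "'a::comm_ring_1 \<times> 'a \<Rightarrow> 'a \<times> 'a \<Rightarrow> 'a \<times> 'a \<Rightarrow> 'a \<times> 'a \<Rightarrow> 'a \<times> 'a \<Rightarrow> 'a \<times> 'a \<Rightarrow> bool" where
  "star p12 p13 p14 p23 p24 p34 \<longleftrightarrow> distinct [p12, p13, p14, p23, p24, p34] \<and>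
     collin p12 p13 p14 \<and> collin p12 p23 p24 \<and> collin p13 p23 p34 \<and> collin p14 p24 p34 \<and>
     \<not> collin p12 p13 p23"

text \<open>Any of these incidences would make two of the four lines coincide, and finally force
  \<open>p12, p13, p23\<close> to be collinear.\<close>

lemma star_off:
  fixes p12 :: "'a::idom \<times> 'a"
  assumes "star p12 p13 p14 p23 p24 p34"
  shows "\<not> collin p12 p13 p23" "\<not> collin p12 p13 p24" "\<not> collin p12 p13 p34"
    "\<not> collin p12 p23 p13" "\<not> collin p12 p23 p14" "\<not> collin p12 p23 p34"
    "\<not> collin p13 p23 p12" "\<not> collin p13 p23 p14" "\<not> collin p13 p23 p24"
    "\<not> collin p14 p24 p12" "\<not> collin p14 p24 p13" "\<not> collin p14 p24 p23"
proof -
  note swap = collin_swap12 collin_swap23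
  have d: "p12 \<noteq> p13" "p12 \<noteq> p14" "p12 \<noteq> p23" "p12 \<noteq> p24" "p13 \<noteq> p14" "p13 \<noteq> p23" "p13 \<noteq> p34"
     "p14 \<noteq> p24" "p14 \<noteq> p34" "p23 \<noteq> p24" "p23 \<noteq> p34" "p24 \<noteq> p34"
    and c: "collin p12 p13 p14" "collin p12 p23 p24" "collin p13 p23 p34" "collin p14 p24 p34"
    and nc: "\<not> collin p12 p13 p23"
    using assms by (auto simp: star_def)
  show 1: "\<not> collin p12 p13 p23" "\<not> collin p12 p13 p24" "\<not> collin p12 p13 p34"
    "\<not> collin p12 p23 p13" "\<not> collin p12 p23 p14" "\<not> collin p12 p23 p34"
    "\<not> collin p13 p23 p12" "\<not> collin p13 p23 p14" "\<not> collin p13 p23 p24"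
    using d c nc collin_join[of p12 p24 p23 p13] collin_join[of p13 p34 p23 p12]
      collin_join[of p12 p14 p13 p23] collin_join[of p23 p34 p13 p12]
      collin_join[of p13 p14 p12 p23] collin_join[of p23 p24 p12 p13]
    by (auto simp: swap)
  show "\<not> collin p14 p24 p12" "\<not> collin p14 p24 p13" "\<not> collin p14 p24 p23"
    using d c nc 1 collin_join[of p12 p14 p13 p24] collin_join[of p13 p14 p12 p24]
      collin_join[of p23 p24 p12 p14]
    by (auto simp: swap)
qed

text \<open>Each of the six points is on two of the four lines, so the four line inequalities bound
  their sum by \<open>2 * tdeg f\<close>, and \<open>P\<close> adds at most \<open>tdeg f\<close>.
  If \<open>f\<close> is one of the lines, it contains just three of the seven points.\<close>

lemma star_outside_bound:
  fixes f :: "'a::field_char_0 poly poly"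
  assumes f: "irreducible f" "ymonic f" and star: "star p12 p13 p14 p23 p24 p34"
    and P: "\<not> collin p12 p13 P" "\<not> collin p12 p23 P" "\<not> collin p13 p23 P" "\<not> collin p14 p24 P"
  shows "mult_at p12 f + mult_at p13 f + mult_at p14 f + mult_at p23 f + mult_at p24 f + mult_at p34 f
    + mult_at P f \<le> 3 * tdeg f"
proof -
  let ?m = "\<lambda>v. mult_at v f"
  let ?on = "\<lambda>P Q. tdeg f = 1 \<and> (\<forall>R. ?m R \<le> 1) \<and> (\<forall>R. \<not> collin P Q R \<longrightarrow> ?m R = 0)"
  note off = star_off[OF star]
  have d: "distinct [p12, p13, p14]" "distinct [p12, p23, p24]" "distinct [p13, p23, p34]" "distinct [p14, p24, p34]"
    and c: "collin p12 p13 p14" "collin p12 p23 p24" "collin p13 p23 p34" "collin p14 p24 p34"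
    using star by (auto simp: star_def)
  have mP: "?m P \<le> tdeg f" using f by (intro mult_at_le_tdeg) (simp add: ymonic_def)
  have "?m p12 + ?m p13 + ?m p14 \<le> tdeg f \<or> ?on p12 p13"
    using bezout_line[OF f _ d(1), of p12 p13] d c by (simp add: add.assoc)
  moreover have "?m p12 + ?m p23 + ?m p24 \<le> tdeg f \<or> ?on p12 p23"
    using bezout_line[OF f _ d(2), of p12 p23] d c by (simp add: add.assoc)
  moreover have "?m p13 + ?m p23 + ?m p34 \<le> tdeg f \<or> ?on p13 p23"
    using bezout_line[OF f _ d(3), of p13 p23] d c by (simp add: add.assoc)
  moreover have "?m p14 + ?m p24 + ?m p34 \<le> tdeg f \<or> ?on p14 p24"
    using bezout_line[OF f _ d(4), of p14 p24] d c by (simp add: add.assoc)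
  ultimately consider "?on p12 p13" | "?on p12 p23" | "?on p13 p23" | "?on p14 p24"
    | "?m p12 + ?m p13 + ?m p14 \<le> tdeg f" "?m p12 + ?m p23 + ?m p24 \<le> tdeg f"
      "?m p13 + ?m p23 + ?m p34 \<le> tdeg f" "?m p14 + ?m p24 + ?m p34 \<le> tdeg f"
    by argo
  then show ?thesis
  proof cases
    case 1
    then have "?m p23 = 0" "?m p24 = 0" "?m p34 = 0" "?m P = 0" "?m p12 \<le> 1" "?m p13 \<le> 1" "?m p14 \<le> 1" "tdeg f = 1"
      using off P by blast+
    then show ?thesis by simp
  next
    case 2
    then have "?m p13 = 0" "?m p14 = 0" "?m p34 = 0" "?m P = 0" "?m p12 \<le> 1" "?m p23 \<le> 1" "?m p24 \<le> 1" "tdeg f = 1"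
      using off P by blast+
    then show ?thesis by simp
  next
    case 3
    then have "?m p12 = 0" "?m p14 = 0" "?m p24 = 0" "?m P = 0" "?m p13 \<le> 1" "?m p23 \<le> 1" "?m p34 \<le> 1" "tdeg f = 1"
      using off P by blast+
    then show ?thesis by simp
  next
    case 4
    then have "?m p12 = 0" "?m p13 = 0" "?m p23 = 0" "?m P = 0" "?m p14 \<le> 1" "?m p24 \<le> 1" "?m p34 \<le> 1" "tdeg f = 1"
      using off P by blast+
    then show ?thesis by simp
  next
    case 5
    then show ?thesis using mP by simp
  qed
qed

text \<open>Sum of seven line inequalities: the four lines of the star, the first one including
  \<open>P\<close>, and the lines joining \<open>P\<close> to \<open>p23\<close>,
  \<open>p24\<close>, \<open>p34\<close>. The weights of \<open>p12, p13, p14\<close> are lowered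
  from two to one, so that the bound survives when \<open>f\<close> is one of the lines.\<close>

lemma star_on_line_bound:
  fixes f :: "'a::field_char_0 poly poly"
  assumes f: "irreducible f" "ymonic f" and star: "star p12 p13 p14 p23 p24 p34"
    and P: "collin p12 p13 P" "\<not> collin p12 p23 P" "\<not> collin p13 p23 P" "\<not> collin p14 p24 P"
  shows "4 * mult_at P f + mult_at p12 f + mult_at p13 f + mult_at p14 f
    + 3 * (mult_at p23 f + mult_at p24 f + mult_at p34 f) \<le> 7 * tdeg f"
proof -
  let ?m = "\<lambda>v. mult_at v f"
  let ?on = "\<lambda>P Q. tdeg f = 1 \<and> (\<forall>R. ?m R \<le> 1) \<and> (\<forall>R. \<not> collin P Q R \<longrightarrow> ?m R = 0)"
  note off = star_off[OF star] and swap = collin_swap12 collin_swap23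
  have c: "collin p12 p13 p14" "collin p12 p23 p24" "collin p13 p23 p34" "collin p14 p24 p34"
    and d0: "distinct [p12, p13, p14, p23, p24, p34]"
    using star by (auto simp: star_def)
  have PQ: "P \<noteq> p12" "P \<noteq> p13" "P \<noteq> p14" "P \<noteq> p23" "P \<noteq> p24" "P \<noteq> p34"
    using P off by auto
  have d: "distinct [p12, p13, p14, P]" "distinct [p12, p23, p24]" "distinct [p13, p23, p34]" "distinct [p14, p24, p34]"
    "distinct [P, p23]" "distinct [P, p24]" "distinct [P, p34]"
    using d0 PQ by auto
  have P14: "collin p12 P p14" using collin_join[of p12 p13 P p14] P c d by simp
  have off23: "\<not> collin P p23 p12" "\<not> collin P p23 p13" "\<not> collin P p23 p14" "\<not> collin P p23 p24" "\<not> collin P p23 p34"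
    using collin_join[of p12 P p23 p13] collin_join[of p13 P p23 p12] collin_join[of p14 P p23 p12]
      collin_join[of p23 p24 P p12] collin_join[of p23 p34 P p13] P P14 c d0 PQ off
    by (auto simp: swap)
  have off24: "\<not> collin P p24 p12" "\<not> collin P p24 p13" "\<not> collin P p24 p14" "\<not> collin P p24 p23" "\<not> collin P p24 p34"
    using collin_join[of p12 P p24 p13] collin_join[of p13 P p24 p12] collin_join[of p14 P p24 p12]
      collin_join[of p23 p24 P p12] collin_join[of p24 p34 P p14] P P14 c d0 PQ off
    by (auto simp: swap)
  have off34: "\<not> collin P p34 p12" "\<not> collin P p34 p13" "\<not> collin P p34 p14" "\<not> collin P p34 p23" "\<not> collin P p34 p24"
    using collin_join[of p12 P p34 p13] collin_join[of p13 P p34 p12] collin_join[of p14 P p34 p12]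
      collin_join[of p14 p34 p12 p24]
      collin_join[of p23 p34 P p13] collin_join[of p24 p34 P p14] P P14 c d0 PQ off
    by (auto simp: swap)
  have "?m p12 + ?m p13 + ?m p14 + ?m P \<le> tdeg f \<or> ?on p12 p13"
    using bezout_line[OF f _ d(1), of p12 p13] d c P by (simp add: add.assoc)
  moreover have "?m p12 + ?m p23 + ?m p24 \<le> tdeg f \<or> ?on p12 p23"
    using bezout_line[OF f _ d(2), of p12 p23] d c by (simp add: add.assoc)
  moreover have "?m p13 + ?m p23 + ?m p34 \<le> tdeg f \<or> ?on p13 p23"
    using bezout_line[OF f _ d(3), of p13 p23] d c by (simp add: add.assoc)
  moreover have "?m p14 + ?m p24 + ?m p34 \<le> tdeg f \<or> ?on p14 p24"
    using bezout_line[OF f _ d(4), of p14 p24] d c by (simp add: add.assoc)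
  moreover have "?m P + ?m p23 \<le> tdeg f \<or> ?on P p23"
    using bezout_line[OF f _ d(5), of P p23] d by simp
  moreover have "?m P + ?m p24 \<le> tdeg f \<or> ?on P p24"
    using bezout_line[OF f _ d(6), of P p24] d by simp
  moreover have "?m P + ?m p34 \<le> tdeg f \<or> ?on P p34"
    using bezout_line[OF f _ d(7), of P p34] d by simp
  ultimately consider "?on p12 p13" | "?on p12 p23" | "?on p13 p23" | "?on p14 p24"
    | "?on P p23" | "?on P p24" | "?on P p34"
    | "?m p12 + ?m p13 + ?m p14 + ?m P \<le> tdeg f" "?m p12 + ?m p23 + ?m p24 \<le> tdeg f"
      "?m p13 + ?m p23 + ?m p34 \<le> tdeg f" "?m p14 + ?m p24 + ?m p34 \<le> tdeg f"
      "?m P + ?m p23 \<le> tdeg f" "?m P + ?m p24 \<le> tdeg f" "?m P + ?m p34 \<le> tdeg f"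
    by argo
  then show ?thesis
  proof cases
    case 1
    then have "?m p23 = 0" "?m p24 = 0" "?m p34 = 0" "?m P \<le> 1" "?m p12 \<le> 1" "?m p13 \<le> 1" "?m p14 \<le> 1" "tdeg f = 1"
      using off by blast+
    then show ?thesis by simp
  next
    case 2
    then have "?m p13 = 0" "?m p14 = 0" "?m p34 = 0" "?m P = 0" "?m p12 \<le> 1" "?m p23 \<le> 1" "?m p24 \<le> 1" "tdeg f = 1"
      using off P by blast+
    then show ?thesis by simp
  next
    case 3
    then have "?m p12 = 0" "?m p14 = 0" "?m p24 = 0" "?m P = 0" "?m p13 \<le> 1" "?m p23 \<le> 1" "?m p34 \<le> 1" "tdeg f = 1"
      using off P by blast+
    then show ?thesis by simp
  next
    case 4
    then have "?m p12 = 0" "?m p13 = 0" "?m p23 = 0" "?m P = 0" "?m p14 \<le> 1" "?m p24 \<le> 1" "?m p34 \<le> 1" "tdeg f = 1"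
      using off P by blast+
    then show ?thesis by simp
  next
    case 5
    then have "?m p12 = 0" "?m p13 = 0" "?m p14 = 0" "?m p24 = 0" "?m p34 = 0" "?m P \<le> 1" "?m p23 \<le> 1" "tdeg f = 1"
      using off23 by blast+
    then show ?thesis by simp
  next
    case 6
    then have "?m p12 = 0" "?m p13 = 0" "?m p14 = 0" "?m p23 = 0" "?m p34 = 0" "?m P \<le> 1" "?m p24 \<le> 1" "tdeg f = 1"
      using off24 by blast+
    then show ?thesis by simp
  next
    case 7
    then have "?m p12 = 0" "?m p13 = 0" "?m p14 = 0" "?m p23 = 0" "?m p24 = 0" "?m P \<le> 1" "?m p34 \<le> 1" "tdeg f = 1"
      using off34 by blast+
    then show ?thesis by simp
  next
    case 8
    then show ?thesis by simp
  qed
qed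

text \<open>Three-point lines are found one after another: a first one \<open>x y z\<close>, a
  second one through a point off it, and a third one through the last point. They form the sides of
  a triangle, each carrying one more point.\<close>

lemma six_points_triangle:
  fixes W :: "('a::idom \<times> 'a) set"
  assumes card: "card W = 6"
    and nocover: "\<And>P Q R S. P \<noteq> Q \<Longrightarrow> R \<noteq> S \<Longrightarrow> \<exists>w\<in>W. \<not> collin P Q w \<and> \<not> collin R S w"
    and inc: "\<And>w. w \<in> W \<Longrightarrow> \<exists>a\<in>W. \<exists>b\<in>W. a \<noteq> w \<and> b \<noteq> w \<and> a \<noteq> b \<and> collin w a b"
  obtains p1 p2 p3 p4 p5 p6 where "W = {p1, p2, p3, p4, p5, p6}" "distinct [p1, p2, p3, p4, p5, p6]"
    "collin p2 p3 p4" "collin p1 p3 p5" "collin p1 p2 p6" "\<not> collin p1 p2 p3"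
proof -
  note swap = collin_swap12 collin_swap23
  have fin: "finite W" using card by (simp add: card_ge_0_finite)
  \<comment> \<open>Four collinear points and the line joining the other two would cover
    \<open>W\<close> by two lines.\<close>
  have no4: False if "distinct [a, b, c, d]" "{a, b, c, d} \<subseteq> W" "collin a b c" "collin a b d" for a b c d
  proof -
    have "card (W - {a, b, c, d}) = 2" using that card fin by (subst card_Diff_subset) auto
    then obtain r s where rs: "W - {a, b, c, d} = {r, s}" "r \<noteq> s" by (auto simp: card_2_iff)
    have "a \<noteq> b" using that(1) by simp
    then obtain w where w: "w \<in> W" "\<not> collin a b w" "\<not> collin r s w"
      using nocover[OF _ rs(2)] by blast
    then have "w \<notin> {r, s}" by auto
    then have "w \<in> {a, b, c, d}" using w(1) rs(1) by blast
    then show False using w(2) that(3,4) by auto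
  qed
  have "W \<noteq> {}" using card by auto
  then obtain x where x: "x \<in> W" by blast
  obtain y z where yz: "y \<in> W" "z \<in> W" "y \<noteq> x" "z \<noteq> x" "y \<noteq> z" "collin x y z"
    using inc[OF x] by blast
  have "card (W - {x, y, z}) = 3" using x yz card fin by (subst card_Diff_subset) auto
  then obtain u v t where uvt: "W - {x, y, z} = {u, v, t}" "u \<noteq> v" "v \<noteq> t" "u \<noteq> t" by (auto simp: card_3_iff)
  have W: "W = {x, y, z, u, v, t}" using x yz uvt(1) by blast
  have "u \<notin> {x, y, z}" "v \<notin> {x, y, z}" "t \<notin> {x, y, z}" using uvt(1) by blast+
  with yz uvt have dist: "distinct [x, y, z, u, v, t]" by auto
  have nuvt: "\<not> collin u v t"
  proof
    assume *: "collin u v t"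
    obtain w where "w \<in> W" "\<not> collin x y w" "\<not> collin u v w" using nocover[of x y u v] dist by auto
    then show False using W yz * by auto
  qed
  have "u \<in> W" using W by simp
  then obtain a b where ab: "a \<in> W" "b \<in> W" "a \<noteq> u" "b \<noteq> u" "a \<noteq> b" "collin u a b"
    using inc by blast
  have "\<exists>x y z u v t. W = {x, y, z, u, v, t} \<and> distinct [x, y, z, u, v, t] \<and> collin x y z \<and> collin x u v"
  proof -
    have xyz: "\<not> collin u x y" "\<not> collin u x z" "\<not> collin u y z"
      using no4[of x y z u] no4[of x z y u] no4[of y z x u] dist yz(6) W by (auto simp: swap)
    \<comment> \<open>The line found for \<open>u\<close> contains at most one of
      \<open>x, y, z\<close>, since otherwise four points would be collinear, and it is not
      \<open>u v t\<close>. So it joins one of \<open>x, y, z\<close> to \<open>v\<close> or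
      \<open>t\<close>.\<close>
    have "collin u x v \<or> collin u y v \<or> collin u z v \<or> collin u x t \<or> collin u y t \<or> collin u z t"
      using ab W xyz nuvt by (auto simp: swap)
    moreover have wit: ?thesis if "W = {x, y, z, u, v, t}" "distinct [x, y, z, u, v, t]" "collin x y z" "collin x u v"
      for x y z u v t
      using that by blast
    ultimately show ?thesis
    proof (elim disjE)
      assume "collin u x v" then show ?thesis
        using W dist yz(6) by (intro wit[of x y z u v t]) (auto simp: swap)
    next
      assume "collin u y v" then show ?thesis
        using W dist yz(6) by (intro wit[of y x z u v t]) (auto simp: swap)
    next
      assume "collin u z v" then show ?thesis
        using W dist yz(6) by (intro wit[of z x y u v t]) (auto simp: swap)
    next
      assume "collin u x t" then show ?thesis
        using W dist yz(6) by (intro wit[of x y z u t v]) (auto simp: swap)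
    next
      assume "collin u y t" then show ?thesis
        using W dist yz(6) by (intro wit[of y x z u t v]) (auto simp: swap)
    next
      assume "collin u z t" then show ?thesis
        using W dist yz(6) by (intro wit[of z x y u t v]) (auto simp: swap)
    qed
  qed
  then obtain x y z u v t where W: "W = {x, y, z, u, v, t}" and dist: "distinct [x, y, z, u, v, t]"
    and c: "collin x y z" "collin x u v" by blast
  have "t \<in> W" using W by simp
  then obtain a b where ab: "a \<in> W" "b \<in> W" "a \<noteq> t" "b \<noteq> t" "a \<noteq> b" "collin t a b"
    using inc by blast
  have n: "\<not> collin t x y" "\<not> collin t x z" "\<not> collin t y z" "\<not> collin t x u" "\<not> collin t x v" "\<not> collin t u v"
    "\<not> collin x y u" "\<not> collin x y v" "\<not> collin x z u" "\<not> collin x z v"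
    using no4[of x y z t] no4[of x z y t] no4[of y z x t] no4[of x u v t] no4[of x v u t] no4[of u v x t]
      no4[of x y z u] no4[of x y z v] no4[of x z y u] no4[of x z y v] dist c W by (auto simp: swap)
  \<comment> \<open>In the same way the line found for \<open>t\<close> joins \<open>y\<close> or
    \<open>z\<close> to \<open>u\<close> or \<open>v\<close>; it is the side of the triangle
    opposite to \<open>x\<close>.\<close>
  have "collin t y u \<or> collin t y v \<or> collin t z u \<or> collin t z v"
    using ab W n by (auto simp: swap)
  then show thesis
  proof (elim disjE)
    assume "collin t y u" then show thesis
      using W dist c n by (intro that[of x y u t v z]) (auto simp: swap)
  next
    assume "collin t y v" then show thesis
      using W dist c n by (intro that[of x y v t u z]) (auto simp: swap)
  next
    assume "collin t z u" then show thesis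
      using W dist c n by (intro that[of x z u t v y]) (auto simp: swap)
  next
    assume "collin t z v" then show thesis
      using W dist c n by (intro that[of x z v t u y]) (auto simp: swap)
  qed
qed

text \<open>A smallest set \<open>W\<close> met fully by no nonzero polynomial of degree at most
  \<open>e\<close> works. Dropping a point yields its separator, and evaluation on \<open>W\<close>
  is then an isomorphism, so \<open>W\<close> has as many points as there are monomials.\<close>

lemma exists_separated:
  fixes Z :: "('a::field_char_0 \<times> 'a) set"
  assumes Z: "finite Z" and none: "\<And>g. tdeg g \<le> e \<Longrightarrow> \<forall>P\<in>Z. poly2 g P = 0 \<Longrightarrow> g = 0"
  obtains W where "W \<subseteq> Z" "finite W" "separated e W" "2 * card W = (e + 1) * (e + 2)"
    "\<forall>g. tdeg g \<le> e \<longrightarrow> (\<forall>P\<in>W. poly2 g P = 0) \<longrightarrow> g = 0"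
proof -
  define good where "good W \<longleftrightarrow> W \<subseteq> Z \<and> (\<forall>g. tdeg g \<le> e \<longrightarrow> (\<forall>P\<in>W. poly2 g P = 0) \<longrightarrow> g = 0)" for W
  have "good Z" using none by (auto simp: good_def)
  then obtain W where W: "good W" "\<And>V. good V \<Longrightarrow> card W \<le> card V"
    using ex_has_least_nat[of good Z card] by blast
  have sub: "W \<subseteq> Z" and noneW: "\<And>g. tdeg g \<le> e \<Longrightarrow> \<forall>P\<in>W. poly2 g P = 0 \<Longrightarrow> g = 0"
    using W(1) by (auto simp: good_def)
  have fin: "finite W" using sub Z by (rule finite_subset)
  have sep: "\<exists>g. tdeg g \<le> e \<and> poly2 g w \<noteq> 0 \<and> (\<forall>v\<in>W - {w}. poly2 g v = 0)" if "w \<in> W" for w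
  proof -
    have "card (W - {w}) < card W" using fin that by (rule card_Diff1_less)
    then have "\<not> good (W - {w})" using W(2)[of "W - {w}"] by auto
    then obtain g where g: "tdeg g \<le> e" "\<forall>v\<in>W - {w}. poly2 g v = 0" "g \<noteq> 0"
      using sub by (auto simp: good_def)
    then have "poly2 g w \<noteq> 0" using noneW[of g] by blast
    with g show ?thesis by blast
  qed
  then obtain G where G: "\<And>w. w \<in> W \<Longrightarrow> tdeg (G w) \<le> e" "\<And>w. w \<in> W \<Longrightarrow> poly2 (G w) w \<noteq> 0"
    "\<And>w v. w \<in> W \<Longrightarrow> v \<in> W \<Longrightarrow> v \<noteq> w \<Longrightarrow> poly2 (G w) v = 0"
    by (metis DiffI singletonD)
  define T where "T = {(i::nat, j). i + j < e + 1}"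
  have finT: "finite T" by (simp add: T_def)
  \<comment> \<open>More points than monomials would make the separators linearly dependent,
    although each is nonzero at exactly one point of \<open>W\<close>.\<close>
  have "card W \<le> card T"
  proof (rule ccontr)
    assume "\<not> ?thesis"
    then obtain x where x: "\<exists>w\<in>W. x w \<noteq> 0" "\<forall>t\<in>T. (\<Sum>w\<in>W. x w * coeff (coeff (G w) (fst t)) (snd t)) = 0"
      using nontrivial_solution[OF finT fin, of "\<lambda>t w. coeff (coeff (G w) (fst t)) (snd t)"] by auto
    define H where "H = (\<Sum>w\<in>W. const2 (x w) * G w)"
    have tH: "tdeg H \<le> e" unfolding H_def
      using fin G(1) by (intro tdeg_sum_le) (auto intro: tdeg_mult_le[of _ 0, simplified])
    have "H = 0"
    proof (rule poly_eqI, rule poly_eqI)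
      fix i j
      show "coeff (coeff H i) j = coeff (coeff 0 i) j"
      proof (cases "i + j \<le> e")
        case True
        then have "(i, j) \<in> T" by (simp add: T_def)
        then show ?thesis using x(2) by (force simp: H_def coeff_sum coeff_const2_mult)
      next
        case False
        then show ?thesis using tH unfolding tdeg_le_iff by simp
      qed
    qed
    have "x w = 0" if "w \<in> W" for w
    proof -
      have "0 = poly2 H w" using \<open>H = 0\<close> by simp
      also have "\<dots> = (\<Sum>v\<in>W. x v * poly2 (G v) w)" by (simp add: H_def poly2_sum)
      also have "\<dots> = x w * poly2 (G w) w + (\<Sum>v\<in>W - {w}. x v * poly2 (G v) w)"
        using fin that by (rule sum.remove)
      also have "(\<Sum>v\<in>W - {w}. x v * poly2 (G v) w) = 0"
        by (intro sum.neutral ballI) (use G(3)[OF _ that] in force)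
      finally show ?thesis using G(2)[OF that] by simp
    qed
    with x(1) show False by blast
  qed
  \<comment> \<open>Fewer points than monomials would leave a nonzero polynomial vanishing on
    \<open>W\<close>.\<close>
  moreover have "card T \<le> card W"
  proof (rule ccontr)
    assume "\<not> ?thesis"
    then obtain x where x: "\<exists>t\<in>T. x t \<noteq> 0" "\<forall>w\<in>W. (\<Sum>t\<in>T. x t * poly2 (bmonom (fst t) (snd t)) w) = 0"
      using nontrivial_solution[OF fin finT, of "\<lambda>w t. poly2 (bmonom (fst t) (snd t)) w"] by auto
    define H where "H = (\<Sum>t\<in>T. const2 (x t) * bmonom (fst t) (snd t))"
    have coeffH: "coeff (coeff H i) j = (if (i, j) \<in> T then x (i, j) else 0)" for i j
      unfolding H_def by (rule coeff_bmonom_sum[OF finT])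
    have "tdeg H \<le> e" unfolding tdeg_le_iff coeffH by (auto simp: T_def)
    moreover have "\<forall>w\<in>W. poly2 H w = 0" using x(2) by (simp add: H_def poly2_sum)
    ultimately have "H = 0" by (rule noneW)
    then have "x t = 0" if "t \<in> T" for t using coeffH[of "fst t" "snd t"] that by simp
    with x(1) show False by blast
  qed
  ultimately have "2 * card W = (e + 1) * (e + 2)"
    using card_triangle[of "e + 1"] by (simp add: T_def)
  moreover have "separated e W" using sep by (auto simp: separated_def)
  ultimately show thesis using that sub fin noneW by blast
qed

lemma separated_degree_bound:
  fixes F :: "'a::field_char_0 poly poly"
  assumes F: "ymonic F" "\<And>P. P \<in> W \<Longrightarrow> m \<le> mult_at P F" and W: "finite W" "separated e W"
  shows "m * card W \<le> (e + 1) * tdeg F"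
proof -
  have "m * card W = (\<Sum>v\<in>W. m)" by simp
  also have "\<dots> \<le> (\<Sum>v\<in>W. mult_at v F)" using F by (intro sum_mono)
  also have "\<dots> \<le> (e + 1) * tdeg F"
  proof (rule ymonic_induct_bound[OF F(1)])
    fix g :: "'a poly poly" assume "g \<noteq> 0" "tdeg g = 0"
    then show "(\<Sum>v\<in>W. mult_at v g) = 0" using mult_at_le_tdeg[of g] by simp
  qed (use separated_total_bound W in \<open>auto simp: mult_at_mult sum.distrib\<close>)
  finally show ?thesis .
qed

text \<open>With multiplicity five everywhere, a point off all four lines would give
  \<open>35 \<le> 33\<close>, and a point on \<open>p12 p13\<close> only would give
  \<open>80 \<le> 77\<close>.\<close>

lemma star_no_seventh_point:
  fixes F :: "'a::field_char_0 poly poly"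
  assumes F: "ymonic F" "tdeg F \<le> 11"
    and star: "star p12 p13 p14 p23 p24 p34"
    and van: "\<And>P. P \<in> {p12, p13, p14, p23, p24, p34, Q} \<Longrightarrow> 5 \<le> mult_at P F"
  shows "collin p12 p23 Q \<or> collin p13 p23 Q \<or> collin p14 p24 Q"
proof (rule ccontr)
  assume "\<not> ?thesis"
  then have Q: "\<not> collin p12 p23 Q" "\<not> collin p13 p23 Q" "\<not> collin p14 p24 Q" by auto
  show False
  proof (cases "collin p12 p13 Q")
    case False
    let ?\<Phi> = "\<lambda>f. mult_at p12 f + mult_at p13 f + mult_at p14 f + mult_at p23 f + mult_at p24 f + mult_at p34 f
      + mult_at Q f"
    have "?\<Phi> F \<le> 3 * tdeg F"
    proof (rule ymonic_induct_bound[OF F(1)])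
      fix g :: "'a poly poly" assume "g \<noteq> 0" "tdeg g = 0"
      then show "?\<Phi> g = 0" using mult_at_le_tdeg[of g] by simp
    qed (use star_outside_bound[OF _ _ star False Q] in \<open>simp_all add: mult_at_mult\<close>)
    then show False
      using F van[of p12] van[of p13] van[of p14] van[of p23] van[of p24] van[of p34] van[of Q] by simp
  next
    case True
    let ?\<Phi> = "\<lambda>f. 4 * mult_at Q f + mult_at p12 f + mult_at p13 f + mult_at p14 f
      + 3 * (mult_at p23 f + mult_at p24 f + mult_at p34 f)"
    have "?\<Phi> F \<le> 7 * tdeg F"
    proof (rule ymonic_induct_bound[OF F(1)])
      fix g :: "'a poly poly" assume "g \<noteq> 0" "tdeg g = 0"
      then show "?\<Phi> g = 0" using mult_at_le_tdeg[of g] by simp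
    qed (use star_on_line_bound[OF _ _ star True Q] in \<open>simp_all add: mult_at_mult\<close>)
    then show False
      using F van[of p12] van[of p13] van[of p14] van[of p23] van[of p24] van[of p34] van[of Q] by simp
  qed
qed

lemma collin_same_line:
  fixes P :: "'a::idom \<times> 'a"
  assumes "collin P Q R" "P \<noteq> Q" "P \<noteq> R"
  shows "collin P R S \<longleftrightarrow> collin P Q S"
  using collin_join[of P Q R S] collin_join[of P R Q S] collin_swap23[of P Q R] assms by blast

text \<open>Renumberings of the four lines that bring each of the others into the distinguished
  first position.\<close>

lemma star_permute:
  fixes p12 :: "'a::idom \<times> 'a"
  assumes "star p12 p13 p14 p23 p24 p34"
  shows "star p12 p23 p24 p13 p14 p34" "star p13 p23 p34 p12 p14 p24" "star p14 p24 p34 p12 p13 p23"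
proof -
  have c: "collin p12 p13 p14" "collin p12 p23 p24" "collin p13 p23 p34" "collin p14 p24 p34"
    and d: "distinct [p12, p13, p14, p23, p24, p34]"
    using assms by (auto simp: star_def)
  note off = star_off[OF assms]
  have c': "collin p23 p13 p34" "collin p24 p14 p34" "collin p13 p12 p14" "collin p23 p12 p24"
      "collin p34 p14 p24" "collin p14 p12 p13" "collin p24 p12 p23" "collin p34 p13 p23"
    using c by (simp_all add: collin_swap12 collin_swap23)
  show "star p12 p23 p24 p13 p14 p34" "star p13 p23 p34 p12 p14 p24" "star p14 p24 p34 p12 p13 p23"
    unfolding star_def using c c' d off by auto
qed

text \<open>By \<open>star_no_seventh_point\<close> and its renumberings, among any three of the
  lines one contains \<open>Q\<close>. So \<open>Q\<close> misses at most two of the four.\<close>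

lemma star_point_on_two_lines:
  fixes F :: "'a::field_char_0 poly poly"
  assumes F: "ymonic F" "tdeg F \<le> 11"
    and star: "star p12 p13 p14 p23 p24 p34"
    and van: "\<And>P. P \<in> {p12, p13, p14, p23, p24, p34, Q} \<Longrightarrow> 5 \<le> mult_at P F"
  shows "collin p12 p13 Q \<and> collin p12 p23 Q \<or> collin p12 p13 Q \<and> collin p13 p23 Q
    \<or> collin p12 p13 Q \<and> collin p14 p24 Q \<or> collin p12 p23 Q \<and> collin p13 p23 Q
    \<or> collin p12 p23 Q \<and> collin p14 p24 Q \<or> collin p13 p23 Q \<and> collin p14 p24 Q"
proof -
  have c: "collin p12 p13 p14" "collin p12 p23 p24" "collin p13 p23 p34" "collin p14 p24 p34"
    and d: "p12 \<noteq> p13" "p12 \<noteq> p14" "p12 \<noteq> p23" "p12 \<noteq> p24" "p13 \<noteq> p23" "p13 \<noteq> p34" "p14 \<noteq> p24" "p14 \<noteq> p34"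
    using star by (auto simp: star_def)
  \<comment> \<open>The renumbered stars name the same lines by other pairs of points.\<close>
  have L: "collin p14 p12 Q \<longleftrightarrow> collin p12 p13 Q" "collin p24 p12 Q \<longleftrightarrow> collin p12 p23 Q"
      "collin p34 p13 Q \<longleftrightarrow> collin p13 p23 Q" "collin p34 p14 Q \<longleftrightarrow> collin p14 p24 Q"
    by (rule trans[OF collin_swap12 collin_same_line[OF c(1) d(1,2)]]
             trans[OF collin_swap12 collin_same_line[OF c(2) d(3,4)]]
             trans[OF collin_swap12 collin_same_line[OF c(3) d(5,6)]]
             trans[OF collin_swap12 collin_same_line[OF c(4) d(7,8)]])+
  have "collin p12 p23 Q \<or> collin p13 p23 Q \<or> collin p14 p24 Q"
    by (rule star_no_seventh_point[OF F star van])
  moreover have "collin p12 p13 Q \<or> collin p23 p13 Q \<or> collin p24 p14 Q"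
    by (rule star_no_seventh_point[OF F star_permute(1)[OF star]]) (rule van, auto)
  moreover have "collin p13 p12 Q \<or> collin p23 p12 Q \<or> collin p34 p14 Q"
    by (rule star_no_seventh_point[OF F star_permute(2)[OF star]]) (rule van, auto)
  moreover have "collin p14 p12 Q \<or> collin p24 p12 Q \<or> collin p34 p13 Q"
    by (rule star_no_seventh_point[OF F star_permute(3)[OF star]]) (rule van, auto)
  ultimately show ?thesis
    using L collin_swap12[of p23 p13 Q] collin_swap12[of p24 p14 Q] collin_swap12[of p13 p12 Q] collin_swap12[of p23 p12 Q]
    by argo
qed

text \<open>Here \<open>e + 1\<close> is the initial degree. Chudnovsky's inequality becomes
  \<open>5 * (e + 2) \<le> 2 * (e + 9)\<close> after cancelling \<open>e + 1\<close>.\<close>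

lemma initial_degree_le_3:
  fixes F :: "'a::field_char_0 poly poly"
  assumes "finite Z" and none: "\<And>g. tdeg g \<le> e \<Longrightarrow> \<forall>P\<in>Z. poly2 g P = 0 \<Longrightarrow> g = 0"
    and F: "ymonic F" "tdeg F \<le> e + 9" "\<And>P. P \<in> Z \<Longrightarrow> 5 \<le> mult_at P F"
  shows "e \<le> 2"
proof -
  obtain W where W: "W \<subseteq> Z" "finite W" "separated e W" "2 * card W = (e + 1) * (e + 2)"
    by (rule exists_separated[OF assms(1) none])
  have "5 * card W \<le> (e + 1) * tdeg F"
    using W F by (intro separated_degree_bound) auto
  also have "\<dots> \<le> (e + 1) * (e + 9)" using F(2) by (rule mult_le_mono2)
  finally have "5 * (2 * card W) \<le> 2 * ((e + 1) * (e + 9))" by simp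
  then have "(e + 1) * (5 * (e + 2)) \<le> (e + 1) * (2 * (e + 9))" unfolding W(4) by (simp only: mult_ac)
  then have "5 * (e + 2) \<le> 2 * (e + 9)" by (simp only: mult_le_cancel1)
  then show ?thesis by simp
qed

lemma four_lines:
  fixes F :: "'a::field_char_0 poly poly"
  assumes "finite Z" and none: "\<And>g. tdeg g \<le> 2 \<Longrightarrow> \<forall>P\<in>Z. poly2 g P = 0 \<Longrightarrow> g = 0"
    and F: "ymonic F" "tdeg F \<le> 11" "\<And>P. P \<in> Z \<Longrightarrow> 5 \<le> mult_at P F"
  obtains l :: "nat \<Rightarrow> 'a poly poly" where "\<And>i. l i \<noteq> 0" "\<And>i. tdeg (l i) \<le> 1"
    "\<And>P. P \<in> Z \<Longrightarrow> \<exists>i<4. \<exists>j<4. i \<noteq> j \<and> poly2 (l i) P = 0 \<and> poly2 (l j) P = 0"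
proof -
  obtain W where W: "W \<subseteq> Z" "finite W" "separated 2 W" "2 * card W = (2 + 1) * (2 + 2)"
    and noneW: "\<forall>g. tdeg g \<le> 2 \<longrightarrow> (\<forall>P\<in>W. poly2 g P = 0) \<longrightarrow> g = 0"
    by (rule exists_separated[OF assms(1) none])
  have card: "card W = 6" using W(4) by simp
  have van: "5 \<le> mult_at P F" if "P \<in> W" for P using that W(1) F(3) by blast
  have inc: "\<exists>a\<in>W. \<exists>b\<in>W. a \<noteq> w \<and> b \<noteq> w \<and> a \<noteq> b \<and> collin w a b" if w: "w \<in> W" for w
  proof (rule ccontr)
    assume no: "\<not> ?thesis"
    have iso: "b \<in> {w, a}" if "a \<in> W" "b \<in> W" "a \<noteq> w" "collin w a b" for a b
      using no that by blast
    let ?\<Phi> = "\<lambda>f. (\<Sum>v\<in>W. mult_at v f) + mult_at w f"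
    \<comment> \<open>For a point on no three-point line this would give
      \<open>6 * 5 + 5 \<le> 33\<close>.\<close>
    have "?\<Phi> F \<le> 3 * tdeg F"
    proof (rule ymonic_induct_bound[OF F(1)])
      fix g :: "'a poly poly" assume "g \<noteq> 0" "tdeg g = 0"
      then show "?\<Phi> g = 0" using mult_at_le_tdeg[of g] by simp
    next
      fix f :: "'a poly poly" assume "irreducible f" "ymonic f"
      then show "?\<Phi> f \<le> 3 * tdeg f" using W w iso by (intro separated_isolated_bound)
    qed (simp add: mult_at_mult sum.distrib)
    moreover have "(\<Sum>v\<in>W. 5) \<le> (\<Sum>v\<in>W. mult_at v F)" using van by (rule sum_mono)
    ultimately show False using card van[OF w] F(2) by simp
  qed
  \<comment> \<open>Two lines covering \<open>W\<close> would multiply to a conic through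
    \<open>W\<close>.\<close>
  have nocover: "\<exists>w\<in>W. \<not> collin P Q w \<and> \<not> collin R S w" if "P \<noteq> Q" "R \<noteq> S" for P Q R S
  proof (rule ccontr)
    assume "\<not> ?thesis"
    then have "\<forall>w\<in>W. poly2 (line P Q * line R S) w = 0" by (auto simp: collin_def)
    moreover have "tdeg (line P Q * line R S) \<le> 2"
      using tdeg_mult_le[OF tdeg_line tdeg_line, of P Q R S] by simp
    ultimately have "line P Q * line R S = 0" using noneW by blast
    then show False using that by (simp add: line_nonzero)
  qed
  obtain p1 p2 p3 p4 p5 p6 where p: "W = {p1, p2, p3, p4, p5, p6}" "distinct [p1, p2, p3, p4, p5, p6]"
    "collin p2 p3 p4" "collin p1 p3 p5" "collin p1 p2 p6" "\<not> collin p1 p2 p3"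
    by (rule six_points_triangle[OF card nocover inc])
  have "collin p4 p5 p6"
  proof (rule ccontr)
    assume nc: "\<not> ?thesis"
    let ?\<Phi> = "\<lambda>f. mult_at p1 f + mult_at p2 f + mult_at p3 f + 2 * (mult_at p4 f + mult_at p5 f + mult_at p6 f)"
    \<comment> \<open>The weights add up to nine, so this would give
      \<open>45 \<le> 44\<close>.\<close>
    have "?\<Phi> F \<le> 4 * tdeg F"
    proof (rule ymonic_induct_bound[OF F(1)])
      fix g :: "'a poly poly" assume "g \<noteq> 0" "tdeg g = 0"
      then show "?\<Phi> g = 0" using mult_at_le_tdeg[of g] by simp
    qed (use triangle_bound[OF _ _ p(2-6) nc] in \<open>simp_all add: mult_at_mult\<close>)
    then show False
      using F(2) van[of p1] van[of p2] van[of p3] van[of p4] van[of p5] van[of p6] p(1) by simp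
  qed
  moreover have "collin p3 p2 p4" "collin p3 p1 p5" "collin p2 p1 p6" "\<not> collin p3 p2 p1"
    using p(3-6) by (simp_all add: collin_swap12 collin_swap23)
  \<comment> \<open>The sides of the triangle are lines one to three, and the fourth line is
    \<open>p4 p5 p6\<close>.\<close>
  ultimately have star: "star p3 p2 p4 p1 p5 p6"
    using p(2) by (auto simp: star_def)
  define l where "l i = (if i = 0 then line p3 p2 else if i = 1 then line p3 p1
      else if i = 2 then line p2 p1 else line p4 p5)" for i :: nat
  show thesis
  proof (rule that[of l])
    show "l i \<noteq> 0" for i using p(2) by (auto simp: l_def line_nonzero)
    show "tdeg (l i) \<le> 1" for i by (simp add: l_def tdeg_line[simplified])
    show "\<exists>i<4. \<exists>j<4. i \<noteq> j \<and> poly2 (l i) P = 0 \<and> poly2 (l j) P = 0" if "P \<in> Z" for P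
    proof -
      have van7: "5 \<le> mult_at R F" if "R \<in> {p3, p2, p4, p1, p5, p6, P}" for R
        using that F(3)[OF \<open>P \<in> Z\<close>] van[of R] p(1) by auto
      have "collin p3 p2 P \<and> collin p3 p1 P \<or> collin p3 p2 P \<and> collin p2 p1 P \<or> collin p3 p2 P \<and> collin p4 p5 P
        \<or> collin p3 p1 P \<and> collin p2 p1 P \<or> collin p3 p1 P \<and> collin p4 p5 P \<or> collin p2 p1 P \<and> collin p4 p5 P"
        by (rule star_point_on_two_lines[OF F(1,2) star]) (rule van7)
      then consider "collin p3 p2 P \<and> collin p3 p1 P" | "collin p3 p2 P \<and> collin p2 p1 P" | "collin p3 p2 P \<and> collin p4 p5 P"
        | "collin p3 p1 P \<and> collin p2 p1 P" | "collin p3 p1 P \<and> collin p4 p5 P" | "collin p2 p1 P \<and> collin p4 p5 P"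
        by argo
      moreover have wit: ?thesis if "poly2 (l i) P = 0 \<and> poly2 (l j) P = 0" "i \<noteq> j" "i < 4" "j < 4" for i j
        using that by blast
      moreover have l: "l 0 = line p3 p2" "l 1 = line p3 p1" "l 2 = line p2 p1" "l 3 = line p4 p5"
        by (simp_all add: l_def)
      ultimately show ?thesis
        unfolding collin_def l[symmetric] by cases (erule wit; simp)+
    qed
  qed
qed

section \<open>Forms and affine charts\<close>

lemma poly_mapping_monomials: "f = (\<Sum>m\<in>Poly_Mapping.keys f. Poly_Mapping.single m (Poly_Mapping.lookup f m))"
proof (rule poly_mapping_eqI)
  fix k
  have "Poly_Mapping.lookup (\<Sum>m\<in>Poly_Mapping.keys f. Poly_Mapping.single m (Poly_Mapping.lookup f m)) k
      = (\<Sum>m\<in>Poly_Mapping.keys f. if m = k then Poly_Mapping.lookup f m else 0)"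
    unfolding lookup_sum by (rule sum.cong) (auto simp: lookup_single when_def)
  then show "Poly_Mapping.lookup f k
      = Poly_Mapping.lookup (\<Sum>m\<in>Poly_Mapping.keys f. Poly_Mapping.single m (Poly_Mapping.lookup f m)) k"
    by (simp add: in_keys_iff)
qed

definition mon3 :: "'b::comm_monoid_mult \<Rightarrow> 'b \<Rightarrow> 'b \<Rightarrow> nat \<times> nat \<times> nat \<Rightarrow> 'b" where
  "mon3 X Y Z m = (case m of (a, b, c) \<Rightarrow> X ^ a * Y ^ b * Z ^ c)"

definition subst3 :: "'a::comm_ring_1 poly poly \<Rightarrow> 'a poly poly \<Rightarrow> 'a poly poly \<Rightarrow> 'a poly3 \<Rightarrow> 'a poly poly" where
  "subst3 X Y Z f = (\<Sum>m\<in>Poly_Mapping.keys f. const2 (Poly_Mapping.lookup f m) * mon3 X Y Z m)"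

lemma subst3_superset:
  assumes "finite S" "Poly_Mapping.keys f \<subseteq> S"
  shows "subst3 X Y Z f = (\<Sum>m\<in>S. const2 (Poly_Mapping.lookup f m) * mon3 X Y Z m)"
  unfolding subst3_def using assms by (intro sum.mono_neutral_left) (auto simp: in_keys_iff)

lemma subst3_add: "subst3 X Y Z (f + g) = subst3 X Y Z f + subst3 X Y Z g"
proof -
  let ?S = "Poly_Mapping.keys f \<union> Poly_Mapping.keys g"
  have "Poly_Mapping.keys (f + g) \<subseteq> ?S" by (rule keys_add)
  then show ?thesis
    by (simp add: subst3_superset[of ?S] lookup_add distrib_right sum.distrib)
qed

lemma subst3_0 [simp]: "subst3 X Y Z 0 = 0"
  by (simp add: subst3_def)

lemma subst3_sum: "subst3 X Y Z (\<Sum>x\<in>A. f x) = (\<Sum>x\<in>A. subst3 X Y Z (f x))"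
  by (induction A rule: infinite_finite_induct) (simp_all add: subst3_add)

lemma subst3_single: "subst3 X Y Z (Poly_Mapping.single m c) = const2 c * mon3 X Y Z m"
  by (simp add: subst3_superset[of "{m}"])

lemma mon3_add: "mon3 X Y Z (m + n) = mon3 X Y Z m * mon3 X Y Z n"
  for X Y Z :: "'b::comm_ring_1"
  by (simp add: mon3_def split_beta power_add mult_ac)

lemma subst3_mult: "subst3 X Y Z (f * g) = subst3 X Y Z f * subst3 X Y Z g"
proof -
  have "f * g = (\<Sum>m\<in>Poly_Mapping.keys f. \<Sum>n\<in>Poly_Mapping.keys g.
      Poly_Mapping.single (m + n) (Poly_Mapping.lookup f m * Poly_Mapping.lookup g n))"
    by (subst (1) poly_mapping_monomials, subst (2) poly_mapping_monomials) (simp add: sum_product mult_single)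
  then show ?thesis
    by (simp add: subst3_sum subst3_single mon3_add)
       (simp add: subst3_def sum_product mult_ac)
qed

lemma subst3_1 [simp]: "subst3 X Y Z 1 = 1"
proof -
  have "mon3 X Y Z 0 = 1" by (simp add: mon3_def zero_prod_def)
  then show ?thesis using subst3_single[of X Y Z 0 1] by simp
qed

lemma subst3_diff: "subst3 X Y Z (f - g) = subst3 X Y Z f - subst3 X Y Z g"
  using subst3_add[of X Y Z "f - g" g] by (simp add: algebra_simps)

lemma subst3_power: "subst3 X Y Z (f ^ n) = subst3 X Y Z f ^ n"
  by (induction n) (simp_all add: subst3_mult)

lemma subst3_prod: "subst3 X Y Z (\<Prod>x\<in>A. f x) = (\<Prod>x\<in>A. subst3 X Y Z (f x))"
  by (induction A rule: infinite_finite_induct) (simp_all add: subst3_mult)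

lemma eval3_altdef:
  "eval3 f (x, y, z) = (\<Sum>m\<in>Poly_Mapping.keys f. Poly_Mapping.lookup f m * mon3 x y z m)"
  by (simp add: eval3_def mon3_def)

lemma poly2_subst3: "poly2 (subst3 X Y Z f) P = eval3 f (poly2 X P, poly2 Y P, poly2 Z P)"
  by (simp add: subst3_def eval3_altdef poly2_sum mon3_def split_beta)

section \<open>Homogeneous polynomials and ideals of points\<close>

lemma mdeg_add: "mdeg (m + n) = mdeg m + mdeg n"
  by (simp add: mdeg_def split_beta)

lemma homogeneous_of_mult:
  "homogeneous_of m f \<Longrightarrow> homogeneous_of n g \<Longrightarrow> homogeneous_of (m + n) (f * g)"
  for f g :: "'a::comm_ring_1 poly3"
proof -
  assume *: "homogeneous_of m f" "homogeneous_of n g"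
  have "mdeg k = m + n" if k: "k \<in> Poly_Mapping.keys (f * g)" for k
  proof -
    obtain i j where "k = i + j" "i \<in> Poly_Mapping.keys f" "j \<in> Poly_Mapping.keys g"
      using keys_mult[of f g] k by blast
    then show ?thesis using * by (simp only: homogeneous_of_def mdeg_add)
  qed
  then show ?thesis by (simp add: homogeneous_of_def)
qed

lemma homogeneous_of_add: "homogeneous_of n f \<Longrightarrow> homogeneous_of n g \<Longrightarrow> homogeneous_of n (f + g)"
  for f g :: "'a::comm_ring_1 poly3"
  using keys_add[of f g] by (auto simp: homogeneous_of_def)

lemma homogeneous_of_single: "mdeg m = n \<Longrightarrow> homogeneous_of n (Poly_Mapping.single m c)"
  by (simp add: homogeneous_of_def)

lemma homogeneous_of_uminus: "homogeneous_of n f \<Longrightarrow> homogeneous_of n (- f)"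
  for f :: "'a::comm_ring_1 poly3"
  by (simp add: homogeneous_of_def in_keys_iff)

lemma homogeneous_of_diff: "homogeneous_of n f \<Longrightarrow> homogeneous_of n g \<Longrightarrow> homogeneous_of n (f - g)"
  for f g :: "'a::comm_ring_1 poly3"
  using homogeneous_of_add[of n f "- g"] by (simp add: homogeneous_of_uminus)

lemma homogeneous_of_1: "homogeneous_of 0 (1 :: 'a::comm_ring_1 poly3)"
  by (simp add: homogeneous_of_def mdeg_def zero_prod_def)

lemma homogeneous_of_power: "homogeneous_of m f \<Longrightarrow> homogeneous_of (m * n) (f ^ n)"
  for f :: "'a::comm_ring_1 poly3"
  by (induction n) (auto simp: homogeneous_of_1 dest: homogeneous_of_mult)

lemma homogeneous_of_sum: "(\<And>x. x \<in> A \<Longrightarrow> homogeneous_of n (f x)) \<Longrightarrow> homogeneous_of n (\<Sum>x\<in>A. f x)"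
  for f :: "'b \<Rightarrow> 'a::comm_ring_1 poly3"
  by (induction A rule: infinite_finite_induct) (auto intro: homogeneous_of_add simp: homogeneous_of_def[of n 0])

lemma homogeneous_of_prod:
  "(\<And>x. x \<in> A \<Longrightarrow> homogeneous_of n (f x)) \<Longrightarrow> homogeneous_of (card A * n) (\<Prod>x\<in>A. f x)"
  for f :: "'b \<Rightarrow> 'a::comm_ring_1 poly3"
  by (induction A rule: infinite_finite_induct) (auto intro: homogeneous_of_mult simp: homogeneous_of_1)

lemma lookup_hcomp: "Poly_Mapping.lookup (hcomp n f) m = (if mdeg m = n then Poly_Mapping.lookup f m else 0)"
proof -
  have "finite {m. (if mdeg m = n then Poly_Mapping.lookup f m else 0) \<noteq> 0}"
    by (rule finite_subset[OF _ finite_keys[of f]]) (auto simp: in_keys_iff)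
  then show ?thesis unfolding hcomp_def by simp
qed

lemma mon3_scale: "mon3 (c * x) (c * y) (c * z) m = c ^ mdeg m * mon3 x y z m"
  for c :: "'a::comm_ring_1"
  by (simp add: mon3_def mdeg_def split_beta power_mult_distrib power_add mult_ac)

lemma eval3_homogeneous_scale:
  "homogeneous_of n f \<Longrightarrow> eval3 f (c * x, c * y, c * z) = c ^ n * eval3 f (x, y, z)"
  for c :: "'a::comm_ring_1"
  by (simp add: eval3_altdef mon3_scale homogeneous_of_def sum_distrib_left mult_ac)

text \<open>Each homogeneous component vanishes at the representative and is only scaled by a power
  of \<open>c\<close>. This allows passing to the representative that a chart selects.\<close>

lemma eval3_scale_IP:
  fixes c :: "'a::comm_ring_1"
  assumes "f \<in> IP (x, y, z)"
  shows "eval3 f (c * x, c * y, c * z) = 0"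
proof -
  have comp: "eval3 (hcomp n f) (x, y, z) =
      (\<Sum>m\<in>{m \<in> Poly_Mapping.keys f. mdeg m = n}. Poly_Mapping.lookup f m * mon3 x y z m)" for n
  proof -
    have "Poly_Mapping.keys (hcomp n f) = {m \<in> Poly_Mapping.keys f. mdeg m = n}"
      by (auto simp: in_keys_iff lookup_hcomp split: if_splits)
    then show ?thesis by (simp add: eval3_altdef lookup_hcomp)
  qed
  have "eval3 f (c * x, c * y, c * z) = (\<Sum>m\<in>Poly_Mapping.keys f. c ^ mdeg m * (Poly_Mapping.lookup f m * mon3 x y z m))"
    by (simp add: eval3_altdef mon3_scale mult_ac)
  also have "\<dots> = (\<Sum>n\<in>mdeg ` Poly_Mapping.keys f. \<Sum>m\<in>{m \<in> Poly_Mapping.keys f. mdeg m = n}.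
      c ^ mdeg m * (Poly_Mapping.lookup f m * mon3 x y z m))"
    by (rule sum.image_gen) simp
  also have "\<dots> = (\<Sum>n\<in>mdeg ` Poly_Mapping.keys f. c ^ n * eval3 (hcomp n f) (x, y, z))"
    unfolding comp sum_distrib_left by (intro sum.cong) auto
  also have "\<dots> = 0" using assms by (simp add: IP_def)
  finally show ?thesis .
qed

lemma homogeneous_in_IP:
  assumes "homogeneous_of n f" "eval3 f P = 0"
  shows "f \<in> IP P"
proof -
  have "hcomp k f = (if k = n then f else 0)" for k
    using assms(1) by (intro poly_mapping_eqI) (auto simp: lookup_hcomp homogeneous_of_def in_keys_iff)
  then show ?thesis using assms(2) by (cases P) (simp add: IP_def eval3_altdef)
qed

lemma ideal_pow_mult:
  assumes "a \<in> ideal_pow I j" "b \<in> ideal_pow I k"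
  shows "a * b \<in> ideal_pow I (j + k)"
  using assms(1) unfolding ideal_pow_def
proof (induction a rule: ideal_gen.induct)
  case (gen g)
  then obtain fs where fs: "g = prod_list fs" "length fs = j" "set fs \<subseteq> I" by blast
  show ?case using assms(2) unfolding ideal_pow_def
  proof (induction b rule: ideal_gen.induct)
    case (gen h)
    then obtain gs where gs: "h = prod_list gs" "length gs = k" "set gs \<subseteq> I" by blast
    have "g * h = prod_list (fs @ gs)" "length (fs @ gs) = j + k" "set (fs @ gs) \<subseteq> I"
      using fs gs by auto
    then show ?case by (blast intro: ideal_gen.gen)
  next
    case (mult a r)
    then show ?case using ideal_gen.mult[of "g * a" _ r] by (simp add: mult_ac)
  qed (simp_all add: ideal_gen.zero ideal_gen.add distrib_left)
next
  case (mult a r)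
  then show ?case using ideal_gen.mult[of "a * b" _ r] by (simp add: mult_ac)
qed (simp_all add: ideal_gen.zero ideal_gen.add distrib_right)

lemma prod_list_in_ideal_pow: "set fs \<subseteq> I \<Longrightarrow> prod_list fs \<in> ideal_pow I (length fs)"
  unfolding ideal_pow_def by (blast intro: ideal_gen.gen)

lemma ideal_pow_mult_left: "a \<in> ideal_pow I j \<Longrightarrow> r * a \<in> ideal_pow I j"
  unfolding ideal_pow_def by (rule ideal_gen.mult)

definition dehom :: "'a::comm_ring_1 poly3 \<Rightarrow> 'a poly poly" where
  "dehom = subst3 (bmonom 0 1) (bmonom 1 0) 1"

text \<open>In a fixed degree the exponents of \<open>x0\<close> and \<open>x1\<close> determine
  that of \<open>x2\<close>, so no terms cancel.\<close>

lemma dehom_nonzero: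
  assumes "homogeneous_of n f" "f \<noteq> 0"
  shows "dehom f \<noteq> 0"
proof -
  obtain a b c where key: "(a, b, c) \<in> Poly_Mapping.keys f"
    using assms(2) by (metis all_not_in_conv keys_eq_empty prod_cases3)
  have "coeff (coeff (dehom f) b) a
      = (\<Sum>m\<in>Poly_Mapping.keys f. if m = (a, b, c) then Poly_Mapping.lookup f m else 0)"
    unfolding dehom_def subst3_def coeff_sum
  proof (rule sum.cong)
    fix m assume m: "m \<in> Poly_Mapping.keys f"
    obtain a' b' c' where m': "m = (a', b', c')" by (cases m)
    have "mdeg (a', b', c') = mdeg (a, b, c)"
      using assms(1) m key unfolding homogeneous_of_def m' by metis
    then have "a' + b' + c' = a + b + c" by (simp add: mdeg_def)
    moreover have "mon3 (bmonom 0 1) (bmonom 1 0) 1 m = (bmonom b' a' :: 'a poly poly)"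
      by (simp add: mon3_def m' bmonom_def monom_power mult_monom)
    ultimately show "coeff (coeff (const2 (Poly_Mapping.lookup f m) * mon3 (bmonom 0 1) (bmonom 1 0) 1 m) b) a
        = (if m = (a, b, c) then Poly_Mapping.lookup f m else 0)"
      by (auto simp: coeff_const2_mult m' bmonom_def)
  qed simp
  also have "\<dots> = Poly_Mapping.lookup f (a, b, c)" using key by simp
  finally show ?thesis using key by (auto simp: in_keys_iff)
qed

lemma coeff_mult_degree_le:
  fixes p q :: "'b::comm_ring_1 poly"
  assumes "degree p \<le> m" "degree q \<le> n"
  shows "coeff (p * q) (m + n) = coeff p m * coeff q n"
proof -
  have "coeff (p * q) (m + n) = (\<Sum>i\<le>m + n. if i = m then coeff p m * coeff q n else 0)"
    unfolding coeff_mult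
  proof (rule sum.cong)
    fix i assume "i \<in> {..m + n}"
    show "coeff p i * coeff q (m + n - i) = (if i = m then coeff p m * coeff q n else 0)"
      using assms by (cases i m rule: linorder_cases) (auto simp: coeff_eq_0)
  qed simp
  then show ?thesis by simp
qed

lemma coeff_power_degree_le_1:
  fixes p :: "'b::comm_ring_1 poly"
  assumes "degree p \<le> 1"
  shows "coeff (p ^ n) n = coeff p 1 ^ n \<and> degree (p ^ n) \<le> n"
proof (induction n)
  case (Suc n)
  then have "degree (p ^ n) \<le> n" "coeff (p ^ n) n = coeff p 1 ^ n" by auto
  then have "coeff (p * p ^ n) (1 + n) = coeff p 1 ^ Suc n" "degree (p * p ^ n) \<le> 1 + n"
    using coeff_mult_degree_le[OF assms, of "p ^ n" n] degree_mult_le[of p "p ^ n"] assms by auto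
  then show ?case by simp
qed simp

context
  fixes \<alpha> \<gamma> \<delta> :: "'a::field_char_0"
begin

text \<open>The affine chart \<open>(x, y) \<mapsto> [1 - \<alpha> x + \<delta> y : x + \<gamma> y : y]\<close>, the complement of the line
  \<open>(x\<^sub>0 - \<delta> x\<^sub>2) + \<alpha> (x\<^sub>1 - \<gamma> x\<^sub>2) = 0\<close>. Its vertical direction is the point \<open>[\<delta> : \<gamma> : 1]\<close>
  at infinity; choosing that point off the curve of a form makes the dehomogenised form monic in \<open>y\<close>.\<close>

definition chart :: "'a poly3 \<Rightarrow> 'a poly poly" where
  "chart = subst3 (1 - const2 \<alpha> * bmonom 0 1 + const2 \<delta> * bmonom 1 0) (bmonom 0 1 + const2 \<gamma> * bmonom 1 0) (bmonom 1 0)"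

definition infinity_form :: "'a \<times> 'a \<times> 'a \<Rightarrow> 'a" where
  "infinity_form P = (case P of (x, y, z) \<Rightarrow> (x - \<delta> * z) + \<alpha> * (y - \<gamma> * z))"

definition affine_point :: "'a \<times> 'a \<times> 'a \<Rightarrow> 'a \<times> 'a" where
  "affine_point P = (case P of (x, y, z) \<Rightarrow> ((y - \<gamma> * z) / infinity_form P, z / infinity_form P))"

text \<open>The form \<open>infinity_form\<close> equals one on the parametrised triples, so
  dividing a representative by its value gives the representative in the chart.\<close>

lemma poly2_chart:
  assumes "infinity_form (x, y, z) \<noteq> 0"
  shows "poly2 (chart f) (affine_point (x, y, z)) = eval3 f
    (inverse (infinity_form (x, y, z)) * x, inverse (infinity_form (x, y, z)) * y, inverse (infinity_form (x, y, z)) * z)"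
proof -
  define h where "h = infinity_form (x, y, z)"
  have h: "h \<noteq> 0" "h = (x - \<delta> * z) + \<alpha> * (y - \<gamma> * z)" using assms by (simp_all add: h_def infinity_form_def)
  have "1 - \<alpha> * ((y - \<gamma> * z) / h) + \<delta> * (z / h) = inverse h * x"
    "(y - \<gamma> * z) / h + \<gamma> * (z / h) = inverse h * y" "z / h = inverse h * z"
    using h(1) by (simp_all add: field_simps) (simp add: h(2) algebra_simps)
  then show ?thesis
    unfolding chart_def poly2_subst3 by (simp add: poly2_bmonom affine_point_def flip: h_def)
qed

text \<open>A generator of the power is a product of \<open>j\<close> factors that all vanish at the
  point, and orders of vanishing add up.\<close>

lemma vanishes_chart:
  assumes "f \<in> ideal_pow (IP P) j" "infinity_form P \<noteq> 0"
  shows "vanishes j (affine_point P) (chart f)"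
proof -
  have IP: "vanishes 1 (affine_point P) (chart f)" if "f \<in> IP P" for f
  proof (cases P)
    case (fields x y z)
    then show ?thesis
      using that assms(2) unfolding vanishes_1_iff by (simp add: poly2_chart eval3_scale_IP)
  qed
  show ?thesis using assms(1) unfolding ideal_pow_def
  proof (induction f rule: ideal_gen.induct)
    case (gen g)
    then obtain fs where fs: "g = prod_list fs" "length fs = j" "set fs \<subseteq> IP P" by blast
    have "vanishes (length fs) (affine_point P) (chart (prod_list fs))" using fs(3)
    proof (induction fs)
      case (Cons f fs)
      then have "vanishes (1 + length fs) (affine_point P) (chart f * chart (prod_list fs))"
        by (intro vanishes_mult IP) auto
      then show ?case by (simp add: chart_def subst3_mult)
    qed simp
    with fs show ?case by simp
  next
    case (add a b)
    then show ?case by (simp add: chart_def subst3_add vanishes_add)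
  next
    case (mult a r)
    then show ?case by (simp add: chart_def subst3_mult vanishes_mult_left)
  qed (simp add: chart_def vanishes_def)
qed

text \<open>The three substituted polynomials have coefficients \<open>\<delta>\<close>,
  \<open>\<gamma>\<close>, \<open>1\<close> at \<open>y\<close>, so the coefficient of
  \<open>y^n\<close> is the value of the form at the vertical point at infinity.\<close>

lemma chart_homogeneous:
  assumes "homogeneous_of n f"
  shows "tdeg (chart f) \<le> n" "coeff (chart f) n = [:eval3 f (\<delta>, \<gamma>, 1):]"
proof -
  let ?X = "1 - const2 \<alpha> * bmonom 0 1 + const2 \<delta> * bmonom 1 0" and ?Y = "bmonom 0 1 + const2 \<gamma> * bmonom 1 0"
    and ?Z = "bmonom 1 0 :: 'a poly poly"
  have td: "tdeg ?X \<le> 1" "tdeg ?Y \<le> 1" "tdeg ?Z \<le> 1"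
    by (auto simp: tdeg_le_iff bmonom_def const2_def coeff_pCons split: nat.split)
  have mon: "tdeg (mon3 ?X ?Y ?Z m) \<le> mdeg m" for m
    unfolding mon3_def mdeg_def split_beta
    by (intro tdeg_mult_le tdeg_power_le[of _ 1, unfolded mult_1_left] td)
  show "tdeg (chart f) \<le> n"
    unfolding chart_def subst3_def
  proof (intro tdeg_sum_le finite_keys)
    fix m assume "m \<in> Poly_Mapping.keys f"
    then have "mdeg m = n" using assms by (simp add: homogeneous_of_def)
    then show "tdeg (const2 (Poly_Mapping.lookup f m) * mon3 ?X ?Y ?Z m) \<le> n"
      using mon[of m] tdeg_mult_le[of "const2 (Poly_Mapping.lookup f m)" 0 "mon3 ?X ?Y ?Z m" n] by simp
  qed
  have deg: "degree ?X \<le> 1" "degree ?Y \<le> 1" "degree ?Z \<le> 1"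
    using td degree_le_tdeg le_trans by blast+
  have lead: "coeff ?X 1 = [:\<delta>:]" "coeff ?Y 1 = [:\<gamma>:]" "coeff ?Z 1 = 1"
    by (simp_all add: bmonom_def const2_def)
  have "coeff (mon3 ?X ?Y ?Z m) (mdeg m) = [:mon3 \<delta> \<gamma> 1 m:]" for m
  proof (cases m)
    case (fields a b c)
    have "coeff (?X ^ a * ?Y ^ b * ?Z ^ c) (a + b + c) = [:\<delta>:] ^ a * [:\<gamma>:] ^ b * 1 ^ c"
    proof -
      note X = coeff_power_degree_le_1[OF deg(1), of a, unfolded lead]
        and Y = coeff_power_degree_le_1[OF deg(2), of b, unfolded lead]
        and Z = coeff_power_degree_le_1[OF deg(3), of c, unfolded lead]
      have "degree (?X ^ a * ?Y ^ b) \<le> a + b"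
        using X Y order_trans[OF degree_mult_le add_mono] by blast
      then show ?thesis
        using X Y Z by (simp only: coeff_mult_degree_le)
    qed
    then show ?thesis by (simp add: fields mon3_def mdeg_def poly_const_pow)
  qed
  then have "coeff (chart f) n = (\<Sum>m\<in>Poly_Mapping.keys f. [:Poly_Mapping.lookup f m * mon3 \<delta> \<gamma> 1 m:])"
    using assms unfolding chart_def subst3_def coeff_sum
    by (intro sum.cong) (auto simp: const2_def homogeneous_of_def)
  then show "coeff (chart f) n = [:eval3 f (\<delta>, \<gamma>, 1):]"
    by (simp add: eval3_altdef flip: sum_to_poly)
qed

text \<open>Inverse of \<open>chart\<close> in degree \<open>n\<close>: \<open>x\<close> becomes
  \<open>x1 - \<gamma> x2\<close>, \<open>y\<close> becomes \<open>x2\<close>, and the missing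
  degree is filled with the equation of the line at infinity, which the chart sends to one.\<close>

definition homogenise :: "nat \<Rightarrow> 'a poly poly \<Rightarrow> 'a poly3" where
  "homogenise n g = (\<Sum>(i, j)\<in>{(i, j). i + j < n + 1}. Poly_Mapping.single 0 (coeff (coeff g i) j)
     * (Poly_Mapping.single (0, 1, 0) 1 - Poly_Mapping.single (0, 0, 1) \<gamma>) ^ j
     * Poly_Mapping.single (0, 0, 1) 1 ^ i
     * (Poly_Mapping.single (1, 0, 0) 1 - Poly_Mapping.single (0, 0, 1) \<delta>
        + (Poly_Mapping.single (0, 1, 0) \<alpha> - Poly_Mapping.single (0, 0, 1) (\<alpha> * \<gamma>))) ^ (n - (i + j)))"

lemma homogeneous_of_homogenise: "homogeneous_of n (homogenise n g)"
  unfolding homogenise_def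
proof (rule homogeneous_of_sum, clarsimp)
  fix i j assume ij: "i + j < Suc n"
  let ?t = "Poly_Mapping.single 0 (coeff (coeff g i) j)
     * (Poly_Mapping.single (0, 1, 0) 1 - Poly_Mapping.single (0, 0, 1) \<gamma>) ^ j
     * Poly_Mapping.single (0, 0, 1) 1 ^ i
     * (Poly_Mapping.single (1, 0, 0) 1 - Poly_Mapping.single (0, 0, 1) \<delta>
        + (Poly_Mapping.single (0, 1, 0) \<alpha> - Poly_Mapping.single (0, 0, 1) (\<alpha> * \<gamma>))) ^ (n - (i + j))"
  have "homogeneous_of (0 + 1 * j + 1 * i + 1 * (n - (i + j))) ?t"
    by (intro homogeneous_of_mult homogeneous_of_power homogeneous_of_diff homogeneous_of_add homogeneous_of_single)
       (simp_all add: mdeg_def zero_prod_def)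
  moreover have "0 + 1 * j + 1 * i + 1 * (n - (i + j)) = n" using ij by simp
  ultimately show "homogeneous_of n (Poly_Mapping.single 0 (coeff (coeff g i) j)
     * (Poly_Mapping.single (0, Suc 0, 0) 1 - Poly_Mapping.single (0, 0, Suc 0) \<gamma>) ^ j
     * Poly_Mapping.single (0, 0, Suc 0) 1 ^ i
     * (Poly_Mapping.single (Suc 0, 0, 0) 1 - Poly_Mapping.single (0, 0, Suc 0) \<delta>
        + (Poly_Mapping.single (0, Suc 0, 0) \<alpha> - Poly_Mapping.single (0, 0, Suc 0) (\<alpha> * \<gamma>))) ^ (n - (i + j)))"
    by (simp only: One_nat_def)
qed

lemma chart_homogenise:
  assumes "tdeg g \<le> n"
  shows "chart (homogenise n g) = g"
proof -
  have "chart (homogenise n g) = (\<Sum>s\<in>{(i, j). i + j < n + 1}.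
      const2 (coeff (coeff g (fst s)) (snd s)) * bmonom (fst s) (snd s))"
    unfolding homogenise_def chart_def subst3_sum
  proof (rule sum.cong, goal_cases)
    case (2 s)
    have "bmonom 0 1 ^ j * bmonom 1 0 ^ i = (bmonom i j :: 'a poly poly)" for i j
      by (simp add: bmonom_def monom_power mult_monom)
    then show ?case
      by (cases s) (simp add: subst3_mult subst3_power subst3_diff subst3_add subst3_single mon3_def zero_prod_def
          algebra_simps)
  qed simp
  also have "\<dots> = g"
  proof (rule poly_eqI, rule poly_eqI)
    fix i j
    show "coeff (coeff (\<Sum>s\<in>{(i, j). i + j < n + 1}.
        const2 (coeff (coeff g (fst s)) (snd s)) * bmonom (fst s) (snd s)) i) j = coeff (coeff g i) j"
      using assms unfolding coeff_bmonom_sum[OF finite_triangle] tdeg_le_iff by auto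
  qed
  finally show ?thesis .
qed

lemma homogenise_in_IP:
  assumes "tdeg g \<le> n" "infinity_form P \<noteq> 0" "poly2 g (affine_point P) = 0"
  shows "homogenise n g \<in> IP P"
proof (cases P)
  case (fields x y z)
  have "inverse (infinity_form P) ^ n * eval3 (homogenise n g) (x, y, z) = poly2 (chart (homogenise n g)) (affine_point P)"
    using assms(2) unfolding fields
    by (simp add: poly2_chart eval3_homogeneous_scale[OF homogeneous_of_homogenise])
  then have "eval3 (homogenise n g) P = 0" using assms by (simp add: chart_homogenise fields)
  then show ?thesis by (rule homogeneous_in_IP[OF homogeneous_of_homogenise])
qed

end

section \<open>Initial degrees\<close>

lemma alpha_le: "f \<in> J \<Longrightarrow> f \<noteq> 0 \<Longrightarrow> homogeneous_of n f \<Longrightarrow> alpha J \<le> n"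
  unfolding alpha_def by (rule Least_le) blast

lemma alpha_attained:
  assumes "f \<in> J" "f \<noteq> 0" "homogeneous_of n f"
  obtains g where "g \<in> J" "g \<noteq> 0" "homogeneous_of (alpha J) g"
  using LeastI[of "\<lambda>n. \<exists>f\<in>J. f \<noteq> 0 \<and> homogeneous_of n f" n] assms unfolding alpha_def by blast

text \<open>A nonzero linear form through \<open>P\<close>; the generic formula would degenerate to
  zero if the first two coordinates vanish.\<close>

definition linear_form :: "'a::comm_ring_1 \<times> 'a \<times> 'a \<Rightarrow> 'a poly3" where
  "linear_form P = (case P of (x, y, z) \<Rightarrow> if x = 0 \<and> y = 0 then Poly_Mapping.single (1, 0, 0) 1
     else Poly_Mapping.single (1, 0, 0) y - Poly_Mapping.single (0, 1, 0) x)"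

lemma homogeneous_linear_form: "homogeneous_of 1 (linear_form P)"
  unfolding linear_form_def
  by (auto split: prod.split intro!: homogeneous_of_diff homogeneous_of_single simp: mdeg_def)

lemma dehom_linear_form: "dehom (linear_form P) \<noteq> 0"
proof (cases P)
  case (fields x y z)
  have "coeff (coeff (dehom (linear_form P)) 0) 1 \<noteq> 0 \<or> coeff (coeff (dehom (linear_form P)) 1) 0 \<noteq> 0"
    by (auto simp: fields linear_form_def dehom_def subst3_diff subst3_single mon3_def coeff_const2_mult)
       (auto simp: bmonom_def)
  then show ?thesis by auto
qed

lemma linear_form_in_IP: "linear_form P \<in> IP P"
proof (rule homogeneous_in_IP[OF homogeneous_linear_form])
  show "eval3 (linear_form P) P = 0"
  proof (cases P)
    case (fields x y z)
    have "eval3 (linear_form P) (x, y, z)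
        = poly2 (subst3 (const2 x) (const2 y) (const2 z) (linear_form P)) (0, 0)"
      by (simp add: poly2_subst3)
    then show ?thesis
      by (simp add: fields linear_form_def subst3_diff subst3_single mon3_def)
  qed
qed

text \<open>Guarantees that the \<open>LEAST\<close> in \<open>alpha\<close> is attained. The
  product of the powers is shown to be nonzero after \<open>dehom\<close>, which is multiplicative
  with values in a domain.\<close>

lemma IZ_nonzero_form:
  fixes Z :: "('a::field_char_0 \<times> 'a \<times> 'a) set"
  assumes "finite Z"
  obtains f n where "f \<in> IZ j Z" "f \<noteq> 0" "homogeneous_of n f"
proof -
  let ?f = "\<Prod>P\<in>Z. linear_form P ^ j"
  have "dehom ?f \<noteq> 0"
    using assms dehom_linear_form[unfolded dehom_def] unfolding dehom_def subst3_prod subst3_power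
    by (metis (no_types, lifting) power_not_zero prod_zero_iff)
  then have "?f \<noteq> 0" by (auto simp: dehom_def)
  moreover have "homogeneous_of (card Z * (1 * j)) ?f"
    by (intro homogeneous_of_prod homogeneous_of_power homogeneous_linear_form)
  moreover have "?f \<in> ideal_pow (IP P) j" if "P \<in> Z" for P
  proof -
    have "linear_form P ^ j \<in> ideal_pow (IP P) j"
      using prod_list_in_ideal_pow[of "replicate j (linear_form P)" "IP P"] linear_form_in_IP[of P]
      by (auto simp: set_replicate_conv_if prod_list_replicate split: if_splits)
    then have "(\<Prod>Q\<in>Z - {P}. linear_form Q ^ j) * linear_form P ^ j \<in> ideal_pow (IP P) j"
      by (rule ideal_pow_mult_left)
    then show ?thesis using assms that by (simp add: prod.remove[of Z P] mult.commute)
  qed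
  then have "?f \<in> IZ j Z" unfolding IZ_def by blast
  ultimately show thesis using that by blast
qed

lemma ideal_pow_eval3:
  assumes "f \<in> ideal_pow (IP P) j" "j > 0"
  shows "eval3 f P = 0"
proof (cases P)
  case (fields x y z)
  \<comment> \<open>Evaluation is written as a substitution of constants to have it
    multiplicative.\<close>
  define E where "E g = poly2 (subst3 (const2 x) (const2 y) (const2 z) g) (0, 0)" for g
  have E: "E g = eval3 g P" for g by (simp add: E_def poly2_subst3 fields)
  have "E f = 0" using assms(1) unfolding ideal_pow_def
  proof (induction f rule: ideal_gen.induct)
    case (gen g)
    then obtain fs where fs: "g = prod_list fs" "length fs = j" "set fs \<subseteq> IP P" by blast
    then obtain h hs where h: "fs = h # hs" using assms(2) by (cases fs) auto
    then have "h \<in> IP P" using fs(3) by simp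
    then have "E h = 0" using eval3_scale_IP[of h x y z 1] by (simp add: E fields)
    then show ?case by (simp add: fs(1) h E_def subst3_mult)
  qed (simp_all add: E_def subst3_add subst3_mult)
  then show ?thesis by (simp add: E)
qed

theorem theorem4p14:
  fixes Z :: "('a::{alg_closed_field, field_char_0} \<times> 'a \<times> 'a) set"
    and k :: nat and p :: int
  assumes "finite Z"
    and "\<forall>P\<in>Z. P \<noteq> (0, 0, 0)"
    and "k \<ge> 5"
    and "\<forall>j\<in>{1..k}. int (alpha (IZ j Z)) = p + 2 * (int j - 1)"
  shows "p = 2"
proof -
  define q where "q = alpha (IZ 1 Z)"
  have p: "p = int q" using assms(3,4) by (auto simp: q_def dest!: bspec[of _ _ 1])
  have alpha2: "alpha (IZ 2 Z) = q + 2" and alpha5: "alpha (IZ 5 Z) = q + 8"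
    using assms(3) bspec[OF assms(4), of 2] bspec[OF assms(4), of 5] p by auto
  have form: "\<exists>f. f \<in> IZ j Z \<and> f \<noteq> 0 \<and> homogeneous_of (alpha (IZ j Z)) f" for j
    using IZ_nonzero_form[OF assms(1), of j] alpha_attained by metis
  \<comment> \<open>The square of a form of degree \<open>q\<close> through \<open>Z\<close> lies in
    \<open>IZ 2 Z\<close>, so \<open>q + 2 \<le> 2 * q\<close>.\<close>
  have "q \<ge> 2"
  proof -
    obtain f where f: "f \<in> IZ 1 Z" "f \<noteq> 0" "homogeneous_of q f" using form[of 1] by (auto simp: q_def)
    have "f * f \<in> IZ 2 Z" using f(1) ideal_pow_mult[of f _ 1 f 1] by (auto simp: IZ_def numeral_2_eq_2)
    moreover have "f * f \<noteq> 0"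
    proof
      assume "f * f = 0"
      then have "dehom f * dehom f = 0" unfolding dehom_def subst3_mult[symmetric] by simp
      then show False using dehom_nonzero[OF f(3,2)] by simp
    qed
    ultimately have "alpha (IZ 2 Z) \<le> q + q" using homogeneous_of_mult[OF f(3,3)] by (rule alpha_le)
    then show ?thesis using alpha2 by simp
  qed
  moreover have False if "q \<ge> 3"
  proof -
    obtain F where F: "F \<in> IZ 5 Z" "F \<noteq> 0" "homogeneous_of (q + 8) F" using form[of 5] by (auto simp: alpha5)
    \<comment> \<open>The vertical point at infinity is chosen off the curve of
      \<open>F\<close>.\<close>
    obtain \<delta> \<gamma> where dg: "poly2 (dehom F) (\<delta>, \<gamma>) \<noteq> 0"
      using poly2_nonzero[OF dehom_nonzero[OF F(3,2)] finite.emptyI] by blast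
    then have F_inf: "eval3 F (\<delta>, \<gamma>, 1) \<noteq> 0" by (simp add: dehom_def poly2_subst3 poly2_bmonom)
    \<comment> \<open>\<open>F\<close> vanishes on \<open>Z\<close>, so no point of \<open>Z\<close>
      is the vertical point at infinity.\<close>
    have off: "x - \<delta> * z \<noteq> 0 \<or> y - \<gamma> * z \<noteq> 0" if P: "(x, y, z) \<in> Z" for x y z
    proof (rule ccontr)
      assume "\<not> ?thesis"
      then have xyz: "x = z * \<delta>" "y = z * \<gamma>" "z = z * 1" by (auto simp: mult.commute)
      then have "z \<noteq> 0" using P assms(2) by auto
      have "F \<in> ideal_pow (IP (x, y, z)) 5" using F(1) P by (auto simp: IZ_def)
      then have "eval3 F (x, y, z) = 0" by (rule ideal_pow_eval3) simp
      then have "z ^ (q + 8) * eval3 F (\<delta>, \<gamma>, 1) = 0"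
        using eval3_homogeneous_scale[OF F(3), of z \<delta> \<gamma> 1] xyz by simp
      then show False using \<open>z \<noteq> 0\<close> F_inf by simp
    qed
    \<comment> \<open>Lines through the vertical point are parametrised by \<open>\<alpha>\<close>,
      and each point of \<open>Z\<close> rules out at most one of them as line at infinity.\<close>
    have "finite {\<alpha>. infinity_form \<alpha> \<gamma> \<delta> P = 0}" if "P \<in> Z" for P
    proof (cases P)
      case (fields x y z)
      have "{\<alpha>. infinity_form \<alpha> \<gamma> \<delta> P = 0} \<subseteq> {- (x - \<delta> * z) / (y - \<gamma> * z)}"
      proof
        fix \<alpha> assume "\<alpha> \<in> {\<alpha>. infinity_form \<alpha> \<gamma> \<delta> P = 0}"
        then have eq: "(x - \<delta> * z) + \<alpha> * (y - \<gamma> * z) = 0" by (simp add: infinity_form_def fields)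
        then have "y - \<gamma> * z \<noteq> 0" using off[of x y z] that fields by auto
        moreover have "\<alpha> * (y - \<gamma> * z) = - (x - \<delta> * z)" using eq by (simp only: eq_neg_iff_add_eq_0 add.commute)
        ultimately show "\<alpha> \<in> {- (x - \<delta> * z) / (y - \<gamma> * z)}" by (simp add: eq_divide_eq)
      qed
      then show ?thesis by (rule finite_subset) simp
    qed
    then have "finite (\<Union>P\<in>Z. {\<alpha>. infinity_form \<alpha> \<gamma> \<delta> P = 0})" using assms(1) by blast
    then obtain \<alpha> where "\<alpha> \<notin> (\<Union>P\<in>Z. {\<alpha>. infinity_form \<alpha> \<gamma> \<delta> P = 0})"
      using ex_new_if_finite[OF infinite_UNIV_char_0] by blast
    then have fin: "infinity_form \<alpha> \<gamma> \<delta> P \<noteq> 0" if "P \<in> Z" for P using that by blast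
    define \<phi> where "\<phi> = chart \<alpha> \<gamma> \<delta>"
    define \<psi> where "\<psi> = homogenise \<alpha> \<gamma> \<delta>"
    define Z' where "Z' = affine_point \<alpha> \<gamma> \<delta> ` Z"
    have "finite Z'" using assms(1) by (simp add: Z'_def)
    have tdegF: "tdeg (\<phi> F) \<le> q + 8" unfolding \<phi>_def by (rule chart_homogeneous[OF F(3)])
    have "coeff (\<phi> F) (q + 8) \<noteq> 0"
      unfolding \<phi>_def chart_homogeneous(2)[OF F(3)] using F_inf by simp
    then have "q + 8 \<le> degree (\<phi> F)" "\<phi> F \<noteq> 0" by (auto intro: le_degree)
    then have ymonicF: "ymonic (\<phi> F)"
      using tdegF degree_le_tdeg[of "\<phi> F"] by (simp add: ymonic_def)
    have multF: "5 \<le> mult_at P (\<phi> F)" if "P \<in> Z'" for P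
    proof -
      obtain Q where Q: "Q \<in> Z" "P = affine_point \<alpha> \<gamma> \<delta> Q" using \<open>P \<in> Z'\<close> unfolding Z'_def by blast
      have "vanishes 5 P (\<phi> F)" unfolding \<phi>_def Q(2)
        by (rule vanishes_chart) (use F(1) Q(1) fin in \<open>auto simp: IZ_def\<close>)
      then show ?thesis using \<open>\<phi> F \<noteq> 0\<close> by (simp add: vanishes_iff_mult_at)
    qed
    \<comment> \<open>Homogenised, such a \<open>g\<close> would be a form through \<open>Z\<close>
      of degree below \<open>q\<close>.\<close>
    have none: "g = 0" if g: "tdeg g \<le> q - 1" "\<forall>P\<in>Z'. poly2 g P = 0" for g
    proof (rule ccontr)
      assume "g \<noteq> 0"
      have "\<phi> (\<psi> (q - 1) g) = g" unfolding \<phi>_def \<psi>_def by (rule chart_homogenise[OF g(1)])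
      then have "\<psi> (q - 1) g \<noteq> 0" using \<open>g \<noteq> 0\<close> by (auto simp: \<phi>_def chart_def)
      moreover have "\<psi> (q - 1) g \<in> ideal_pow (IP P) 1" if "P \<in> Z" for P
      proof -
        have "\<psi> (q - 1) g \<in> IP P" unfolding \<psi>_def
          using g(2) that by (intro homogenise_in_IP[OF g(1)] fin) (auto simp: Z'_def)
        then show ?thesis using prod_list_in_ideal_pow[of "[\<psi> (q - 1) g]"] by simp
      qed
      then have "\<psi> (q - 1) g \<in> IZ 1 Z" unfolding IZ_def by blast
      ultimately have "q \<le> q - 1" unfolding q_def \<psi>_def
        using homogeneous_of_homogenise alpha_le by blast
      then show False using \<open>q \<ge> 3\<close> by simp
    qed
    have "q - 1 \<le> 2"
      by (rule initial_degree_le_3[OF \<open>finite Z'\<close> none ymonicF _ multF]) (use tdegF \<open>q \<ge> 3\<close> in auto)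
    then have "q = 3" using \<open>q \<ge> 3\<close> by simp
    obtain l :: "nat \<Rightarrow> 'a poly poly" where l: "\<And>i. l i \<noteq> 0" "\<And>i. tdeg (l i) \<le> 1"
      and two: "\<And>P. P \<in> Z' \<Longrightarrow> \<exists>i<4. \<exists>j<4. i \<noteq> j \<and> poly2 (l i) P = 0 \<and> poly2 (l j) P = 0"
      using four_lines[OF \<open>finite Z'\<close> _ ymonicF _ multF] none tdegF \<open>q = 3\<close> by auto
    \<comment> \<open>The quartic formed by the four homogenised lines; two of its factors vanish at
      each point of \<open>Z\<close>.\<close>
    define f where "f = (\<Prod>i<4. \<psi> 1 (l i))"
    have "\<phi> f = (\<Prod>i<4. l i)"
      unfolding f_def \<phi>_def chart_def subst3_prod
      unfolding \<psi>_def by (rule prod.cong[OF refl chart_homogenise[OF l(2), unfolded chart_def]])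
    then have "\<phi> f \<noteq> 0" using l(1) by simp
    then have "f \<noteq> 0" by (auto simp: \<phi>_def chart_def)
    moreover have "f \<in> ideal_pow (IP P) 2" if P: "P \<in> Z" for P
    proof -
      have "affine_point \<alpha> \<gamma> \<delta> P \<in> Z'" using P by (simp add: Z'_def)
      then obtain i j where ij: "i < 4" "j < 4" "i \<noteq> j"
        "poly2 (l i) (affine_point \<alpha> \<gamma> \<delta> P) = 0" "poly2 (l j) (affine_point \<alpha> \<gamma> \<delta> P) = 0"
        using two by blast
      have "\<psi> 1 (l i) \<in> IP P" "\<psi> 1 (l j) \<in> IP P"
        unfolding \<psi>_def by (rule homogenise_in_IP[OF l(2) fin[OF P] ij(4)] homogenise_in_IP[OF l(2) fin[OF P] ij(5)])+
      then have "(\<Prod>i\<in>{..<4} - {i} - {j}. \<psi> 1 (l i)) * prod_list [\<psi> 1 (l i), \<psi> 1 (l j)] \<in> ideal_pow (IP P) (length [\<psi> 1 (l i), \<psi> 1 (l j)])"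
        by (intro ideal_pow_mult_left prod_list_in_ideal_pow) simp
      moreover have "f = \<psi> 1 (l i) * (\<psi> 1 (l j) * (\<Prod>i\<in>{..<4} - {i} - {j}. \<psi> 1 (l i)))"
        unfolding f_def using ij by (simp add: prod.remove[of _ i] prod.remove[of _ j])
      ultimately show ?thesis by (simp add: mult_ac numeral_2_eq_2)
    qed
    then have "f \<in> IZ 2 Z" unfolding IZ_def by blast
    moreover have "homogeneous_of (card {..<4::nat} * 1) f"
      unfolding f_def \<psi>_def by (intro homogeneous_of_prod homogeneous_of_homogenise)
    ultimately have "alpha (IZ 2 Z) \<le> 4" using alpha_le[of f "IZ 2 Z" 4] by simp
    then show False using alpha2 \<open>q = 3\<close> by simp
  qed
  ultimately show ?thesis using p by fastforce
qed

end
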